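(* Let $A$ be a commutative Noetherian ring containing a field $K$ of characteristic zero, let $m\ge 1$, and let $R=A[X_1,\ldots,X_m]$ be standard graded over $A$. Let $I$ be a homogeneous ideal of $R$, let $i\ge 0$, and let $M:=H^i_I(R)=\bigoplus_{n\in\mathbb{Z}}M_n$. If $M_n=0$ for all $|n|\gg 0$, then $M=0$.
   Context: The standard grading on $R=A[X_1,\ldots,X_m]$ is given by $\deg z=0$ for all $z\in A$ and $\deg X_j=1$ for $j=1,\ldots,m$. For a homogeneous ideal $I$, $H^i_I(R)$ is the $i$-th local cohomology module of $R$ with support in $I$, with its natural structure of $\mathbb{Z}$-graded $R$-module; $M_n$ denotes its degree $n$ component. *)

theory Defs
  imports
    "HOL-Library.Poly_Mapping"
    "HOL-Algebra.Ring_Divisibility"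
    "HOL-Algebra.Ideal_Product"
    "HOL-Algebra.QuotRing"
    "HOL-Algebra.Algebraic_Closure_Type"
begin

section \<open>Graded modules\<close>

text \<open>
  A \<open>\<int>\<close>-graded ring is represented by the same record, as a graded module over itself. As for
  \<^typ>\<open>('r, 'e) module\<close>, the fields \<open>mult\<close> and \<open>one\<close> carry no information for a module.
\<close>

record ('r, 'e) graded_module = "('r, 'e) module" +
  component :: "int \<Rightarrow> 'e set"

text \<open>
  The last conjunct says that \<open>M\<close> is the internal direct sum of its components: \<open>f n\<close> is the
  degree \<open>n\<close> part of \<open>x\<close>.
\<close>

definition graded_module ::
  "('r, 'r, 'x) graded_module_scheme \<Rightarrow> ('r, 'e, 'y) graded_module_scheme \<Rightarrow> bool" where
  "graded_module S M \<longleftrightarrow>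
     module S M \<and>
     (\<forall>n. subgroup (component M n) (add_monoid M)) \<and>
     (\<forall>k n. \<forall>r\<in>component S k. \<forall>x\<in>component M n. r \<odot>\<^bsub>M\<^esub> x \<in> component M (k + n)) \<and>
     (\<forall>x\<in>carrier M. \<exists>!f. (\<forall>n. f n \<in> component M n) \<and> finite {n. f n \<noteq> \<zero>\<^bsub>M\<^esub>} \<and>
        x = finsum M f {n. f n \<noteq> \<zero>\<^bsub>M\<^esub>})"

definition graded_hom ::
  "('r, 'r, 'x) graded_module_scheme \<Rightarrow> ('r, 'e, 'y) graded_module_scheme \<Rightarrow>
   ('r, 'f, 'z) graded_module_scheme \<Rightarrow> ('e \<Rightarrow> 'f) set" where
  "graded_hom S M N =
     {h \<in> carrier M \<rightarrow> carrier N.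
        (\<forall>x\<in>carrier M. \<forall>y\<in>carrier M. h (x \<oplus>\<^bsub>M\<^esub> y) = h x \<oplus>\<^bsub>N\<^esub> h y) \<and>
        (\<forall>r\<in>carrier S. \<forall>x\<in>carrier M. h (r \<odot>\<^bsub>M\<^esub> x) = r \<odot>\<^bsub>N\<^esub> h x) \<and>
        (\<forall>n. h ` component M n \<subseteq> component N n)}"

definition homogeneous_ideal :: "'r set \<Rightarrow> ('r, 'r, 'x) graded_module_scheme \<Rightarrow> bool" where
  "homogeneous_ideal I S \<longleftrightarrow> ideal I S \<and> Idl\<^bsub>S\<^esub> (I \<inter> (\<Union>n. component S n)) = I"

definition graded_restrict ::
  "('r, 'e) graded_module \<Rightarrow> 'e set \<Rightarrow> ('r, 'e) graded_module" where
  "graded_restrict M N = M\<lparr>carrier := N, component := (\<lambda>n. component M n \<inter> N)\<rparr>"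

text \<open>
  \<open>M / B\<close> for a graded submodule \<open>B\<close>, on the set of cosets. Adding \<open>B\<close> in the scalar multiplication turns
  \<open>r \<cdot> (B + x) = r \<cdot> B + r \<cdot> x\<close> into the full coset \<open>B + r \<cdot> x\<close>.
\<close>

definition graded_quotient ::
  "('r, 'e) graded_module \<Rightarrow> 'e set \<Rightarrow> ('r, 'e set) graded_module" where
  "graded_quotient M B =
     \<lparr>carrier = a_rcosets\<^bsub>M\<^esub> B, monoid.mult = undefined, one = undefined,
      zero = B, add = set_add M,
      module.smult = (\<lambda>r Y. B <+>\<^bsub>M\<^esub> ((\<lambda>x. r \<odot>\<^bsub>M\<^esub> x) ` Y)),
      component = (\<lambda>n. (\<lambda>x. B +>\<^bsub>M\<^esub> x) ` component M n)\<rparr>"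


section \<open>Injective resolutions in the category of graded modules\<close>

text \<open>
  HOL cannot quantify over all types inside a definition, so the test modules \<open>N\<close>, \<open>N'\<close> range over
  the graded modules whose elements lie in a given type \<^typ>\<open>'u\<close>. By the graded form of Baer's
  criterion it suffices to test on the inclusions \<open>J(n) \<subseteq> S(n)\<close> for homogeneous ideals \<open>J\<close> of \<open>S\<close>
  and shifts \<open>n\<close>, so this is injectivity in the category of all graded \<open>S\<close>-modules as soon as
  \<^typ>\<open>'r\<close> embeds into \<^typ>\<open>'u\<close>.
\<close>

definition graded_injective ::
  "'u itself \<Rightarrow> ('r, 'r) graded_module \<Rightarrow> ('r, 'e) graded_module \<Rightarrow> bool" where
  "graded_injective U S E \<longleftrightarrow>
     (\<forall>(N :: ('r, 'u) graded_module) (N' :: ('r, 'u) graded_module) j \<phi>.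
        graded_module S N \<longrightarrow> graded_module S N' \<longrightarrow>
        j \<in> graded_hom S N N' \<longrightarrow> inj_on j (carrier N) \<longrightarrow> \<phi> \<in> graded_hom S N E \<longrightarrow>
        (\<exists>\<psi>\<in>graded_hom S N' E. \<forall>x\<in>carrier N. \<psi> (j x) = \<phi> x))"

text \<open>
  The test type \<open>('r + 'e) list\<close> contains copies of \<open>S\<close>, of every \<open>E i\<close> and of their finite direct
  sums; by the previous remark any type containing \<^typ>\<open>'r\<close> would give the same notion.
\<close>

definition graded_injective_resolution ::
  "('r, 'r) graded_module \<Rightarrow> ('r, 'b) graded_module \<Rightarrow> ('b \<Rightarrow> 'e) \<Rightarrow>
   (nat \<Rightarrow> ('r, 'e) graded_module) \<Rightarrow> (nat \<Rightarrow> 'e \<Rightarrow> 'e) \<Rightarrow> bool" where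
  "graded_injective_resolution S M \<epsilon> E d \<longleftrightarrow>
     (\<forall>i. graded_module S (E i) \<and> graded_injective TYPE(('r + 'e) list) S (E i)) \<and>
     \<epsilon> \<in> graded_hom S M (E 0) \<and> (\<forall>i. d i \<in> graded_hom S (E i) (E (Suc i))) \<and>
     inj_on \<epsilon> (carrier M) \<and>
     \<epsilon> ` carrier M = {x \<in> carrier (E 0). d 0 x = \<zero>\<^bsub>E 1\<^esub>} \<and>
     (\<forall>i. d i ` carrier (E i) =
        {x \<in> carrier (E (Suc i)). d (Suc i) x = \<zero>\<^bsub>E (Suc (Suc i))\<^esub>})"


section \<open>Local cohomology\<close>

definition cocycles :: "(nat \<Rightarrow> ('r, 'e) graded_module) \<Rightarrow> (nat \<Rightarrow> 'e \<Rightarrow> 'e) \<Rightarrow> nat \<Rightarrow> 'e set" where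
  "cocycles C d i = {x \<in> carrier (C i). d i x = \<zero>\<^bsub>C (Suc i)\<^esub>}"

definition coboundaries :: "(nat \<Rightarrow> ('r, 'e) graded_module) \<Rightarrow> (nat \<Rightarrow> 'e \<Rightarrow> 'e) \<Rightarrow> nat \<Rightarrow> 'e set"
  where
  "coboundaries C d i = (case i of 0 \<Rightarrow> {\<zero>\<^bsub>C 0\<^esub>} | Suc j \<Rightarrow> d j ` carrier (C j))"

definition cohomology ::
  "(nat \<Rightarrow> ('r, 'e) graded_module) \<Rightarrow> (nat \<Rightarrow> 'e \<Rightarrow> 'e) \<Rightarrow> nat \<Rightarrow> ('r, 'e set) graded_module" where
  "cohomology C d i = graded_quotient (graded_restrict (C i) (cocycles C d i)) (coboundaries C d i)"

text \<open>\<open>\<Gamma>\<^sub>I(M)\<close>, the submodule of elements annihilated by some power of \<open>I\<close>.\<close>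

definition torsion_part ::
  "('r, 'r) graded_module \<Rightarrow> 'r set \<Rightarrow> ('r, 'e) graded_module \<Rightarrow> ('r, 'e) graded_module" where
  "torsion_part S I M = graded_restrict M
     {x \<in> carrier M. \<exists>k::nat. \<forall>a \<in> I [^]\<^bsub>ideals_set S\<^esub> k. a \<odot>\<^bsub>M\<^esub> x = \<zero>\<^bsub>M\<^esub>}"

text \<open>
  \<open>H\<^sup>i\<^sub>I(M)\<close> is the \<open>i\<close>-th right derived functor of \<open>\<Gamma>\<^sub>I\<close>, computed from an injective resolution
  \<open>(E, d)\<close> of \<open>M\<close>. Its natural grading comes from taking the resolution in the category of graded
  modules. A resolution determines it up to unique isomorphism of graded modules, so statements
  about \<open>H\<^sup>i\<^sub>I(M)\<close> quantify over all resolutions.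
\<close>

definition local_cohomology ::
  "('r, 'r) graded_module \<Rightarrow> 'r set \<Rightarrow> (nat \<Rightarrow> ('r, 'e) graded_module) \<Rightarrow> (nat \<Rightarrow> 'e \<Rightarrow> 'e) \<Rightarrow>
   nat \<Rightarrow> ('r, 'e set) graded_module" where
  "local_cohomology S I E d i = cohomology (\<lambda>j. torsion_part S I (E j)) d i"


section \<open>Standard graded polynomial rings\<close>

text \<open>
  \<open>A[X\<^sub>v | v :: 'v]\<close> as the monoid algebra of the exponent vectors \<^typ>\<open>'v \<Rightarrow>\<^sub>0 nat\<close>. The index type
  is finite and nonempty, so \<open>m = CARD('v) \<ge> 1\<close> is arbitrary.
\<close>

type_synonym ('v, 'a) mpolynomial = "('v \<Rightarrow>\<^sub>0 nat) \<Rightarrow>\<^sub>0 'a"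

definition standard_graded_polynomial_ring ::
  "(('v::finite, 'a::comm_ring_1) mpolynomial, ('v, 'a) mpolynomial) graded_module" where
  "standard_graded_polynomial_ring =
     \<lparr>carrier = UNIV, monoid.mult = (*), one = 1, zero = 0, add = (+), module.smult = (*),
      component = (\<lambda>n. {p. \<forall>t\<in>Poly_Mapping.keys p. int (\<Sum>v\<in>UNIV. Poly_Mapping.lookup t v) = n})\<rparr>"

end

theory Submission
  imports Defs
begin

text \<open>
  Fix a variable \<open>X = X\<^sub>v\<close> and let \<open>\<delta> = \<partial>/\<partial>X\<close>. The theorem rests on one fact: \<open>\<delta>\<close> acts on
  \<open>H = H\<^sup>i\<^sub>I(R)\<close> through an additive operator \<open>D\<close> with \<open>D (r z) = r (D z) + (\<delta> r) z\<close>. Granted this, let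
  \<open>H\<close> be concentrated in finitely many degrees. As multiplication by \<open>X\<^sup>N\<close> raises degrees by \<open>N\<close>, it is
  zero on \<open>H\<close> for some \<open>N\<close>. If \<open>X\<^sup>n\<^sup>+\<^sup>1\<close> is zero on \<open>H\<close>, then so is \<open>X\<^sup>n\<close>: indeed
  \<open>(n + 1) X\<^sup>n z = D (X\<^sup>n\<^sup>+\<^sup>1 z) - X\<^sup>n\<^sup>+\<^sup>1 (D z) = 0\<close>, and \<open>n + 1\<close> is invertible in \<open>K\<close>. Descending to
  \<open>X\<^sup>0 = 1\<close> gives \<open>H = 0\<close> (\<open>connection_descent\<close>, \<open>local_cohomology_eq_zero\<close>).

  The operator \<open>D\<close> is constructed on the given injective resolution. A connection on a module \<open>E\<close>
  over \<open>\<delta>\<close>, that is, an operator with the Leibniz rule above, is the same as a linear section of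
  the first projection of the module of jets \<open>E \<oplus> E\<close>, where \<open>r (x, y) = (r x, r y + (\<delta> r) x)\<close>.
  If \<open>E\<close> is injective, a section exists and can be prescribed on the image of a homomorphism whose
  source has a connection preserving the kernel (\<open>extend_connection\<close>). Starting from \<open>\<delta>\<close> on \<open>R\<close> and
  moving along the resolution, this yields connections on all terms that commute with the
  differentials (\<open>resolution_connections\<close>). A connection maps elements killed by \<open>I\<^sup>k\<close> to elements
  killed by \<open>I\<^sup>k\<^sup>+\<^sup>1\<close> (\<open>power_annihilates_connection\<close>), so it acts on the torsion complex and on its
  cohomology. The homogeneity of \<open>I\<close> makes the torsion submodules graded, which lets the degree
  argument be carried out on cocycles, one homogeneous part at a time
  (\<open>power_annihilates_degree_part\<close>).
\<close>

section \<open>Graded modules and their projections\<close>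

text \<open>
  The decomposition of an element into homogeneous parts is a function satisfying a condition on a
  finite sum. A family of additive projections is easier to produce, because it is built
  componentwise for products, kernels and copies of modules; the sum of the projections of \<open>x\<close> is
  recovered as \<open>x\<close> since the difference has all projections zero.
\<close>

lemma graded_moduleI:
  assumes "module S M"
    and comp_carrier: "\<And>n. component M n \<subseteq> carrier M"
    and zero_comp: "\<And>n. \<zero>\<^bsub>M\<^esub> \<in> component M n"
    and add_comp: "\<And>n x y. x \<in> component M n \<Longrightarrow> y \<in> component M n \<Longrightarrow> x \<oplus>\<^bsub>M\<^esub> y \<in> component M n"
    and neg_comp: "\<And>n x. x \<in> component M n \<Longrightarrow> \<exists>y\<in>component M n. y \<oplus>\<^bsub>M\<^esub> x = \<zero>\<^bsub>M\<^esub>"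
    and smult: "\<And>k n r x. r \<in> component S k \<Longrightarrow> x \<in> component M n \<Longrightarrow> r \<odot>\<^bsub>M\<^esub> x \<in> component M (k + n)"
    and p_comp: "\<And>n x. x \<in> carrier M \<Longrightarrow> p n x \<in> component M n"
    and p_add: "\<And>n x y. x \<in> carrier M \<Longrightarrow> y \<in> carrier M \<Longrightarrow> p n (x \<oplus>\<^bsub>M\<^esub> y) = p n x \<oplus>\<^bsub>M\<^esub> p n y"
    and p_id: "\<And>n x. x \<in> component M n \<Longrightarrow> p n x = x"
    and p_other: "\<And>m n x. x \<in> component M n \<Longrightarrow> m \<noteq> n \<Longrightarrow> p m x = \<zero>\<^bsub>M\<^esub>"
    and p_finite: "\<And>x. x \<in> carrier M \<Longrightarrow> finite {n. p n x \<noteq> \<zero>\<^bsub>M\<^esub>}"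
    and p_separate: "\<And>x. x \<in> carrier M \<Longrightarrow> (\<And>n. p n x = \<zero>\<^bsub>M\<^esub>) \<Longrightarrow> x = \<zero>\<^bsub>M\<^esub>"
  shows "graded_module S M"
proof -
  interpret M: module S M by fact
  have comp: "subgroup (component M n) (add_monoid M)" for n
  proof (intro subgroup.intro)
    fix x assume x: "x \<in> component M n"
    then obtain y where "y \<in> component M n" "y \<oplus>\<^bsub>M\<^esub> x = \<zero>\<^bsub>M\<^esub>" using neg_comp by blast
    moreover from this x have "\<ominus>\<^bsub>M\<^esub> x = y"
      using comp_carrier by (meson M.minus_equality subsetD)
    ultimately show "inv\<^bsub>add_monoid M\<^esub> x \<in> component M n" by (simp add: a_inv_def)
  qed (use comp_carrier zero_comp add_comp in auto)
  have p_carrier: "p n x \<in> carrier M" if "x \<in> carrier M" for n x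
    using p_comp[OF that] comp_carrier by blast
  have p_zero: "p n \<zero>\<^bsub>M\<^esub> = \<zero>\<^bsub>M\<^esub>" for n
    by (rule p_id[OF zero_comp])
  have p_sum: "p m (finsum M f F) = (if m \<in> F then f m else \<zero>\<^bsub>M\<^esub>)"
    if "finite F" "\<And>n. f n \<in> component M n" for m f F
    using that(1)
  proof (induction F rule: finite_induct)
    case empty
    show ?case by (simp add: p_zero)
  next
    case (insert a F)
    have fc: "f \<in> B \<rightarrow> carrier M" for B
      using that(2) comp_carrier by blast
    have "p m (finsum M f (insert a F)) = p m (f a) \<oplus>\<^bsub>M\<^esub> p m (finsum M f F)"
      using insert(1,2) fc[of F] fc[of UNIV]
      by (subst M.M.finsum_insert) (auto intro!: p_add M.M.finsum_closed simp: Pi_def)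
    also have "\<dots> = (if m \<in> insert a F then f m else \<zero>\<^bsub>M\<^esub>)"
      using insert fc[of UNIV] p_id[OF that(2)] p_other[OF that(2)]
      by (cases "m = a") (auto simp: Pi_def)
    finally show ?case .
  qed
  have "\<exists>!f. (\<forall>n. f n \<in> component M n) \<and> finite {n. f n \<noteq> \<zero>\<^bsub>M\<^esub>} \<and>
        x = finsum M f {n. f n \<noteq> \<zero>\<^bsub>M\<^esub>}" if x: "x \<in> carrier M" for x
  proof (rule ex1I[of _ "\<lambda>n. p n x"])
    let ?F = "{n. p n x \<noteq> \<zero>\<^bsub>M\<^esub>}" and ?y = "finsum M (\<lambda>n. p n x) {n. p n x \<noteq> \<zero>\<^bsub>M\<^esub>}"
    have y: "?y \<in> carrier M"
      using p_carrier[OF x] by (simp add: M.M.finsum_closed)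
    have cancel: "(x \<ominus>\<^bsub>M\<^esub> ?y) \<oplus>\<^bsub>M\<^esub> ?y = x"
      using x y by (simp add: M.minus_eq M.M.a_assoc M.M.l_neg)
    have "p m (x \<ominus>\<^bsub>M\<^esub> ?y) = \<zero>\<^bsub>M\<^esub>" for m
    proof -
      have "p m ((x \<ominus>\<^bsub>M\<^esub> ?y) \<oplus>\<^bsub>M\<^esub> ?y) = p m (x \<ominus>\<^bsub>M\<^esub> ?y) \<oplus>\<^bsub>M\<^esub> p m ?y"
        using x y by (simp add: p_add)
      moreover note cancel
      moreover have "p m ?y = p m x"
        using p_sum[OF p_finite[OF x], of "\<lambda>n. p n x" m] p_comp[OF x] by auto
      ultimately show ?thesis
        using x y p_carrier[of _ m] by (simp add: M.M.add.r_cancel_one')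
    qed
    hence "x \<ominus>\<^bsub>M\<^esub> ?y = \<zero>\<^bsub>M\<^esub>"
      using x y p_separate by simp
    hence "x = ?y" using y cancel by simp
    thus "(\<forall>n. p n x \<in> component M n) \<and> finite ?F \<and> x = ?y"
      using p_comp[OF x] p_finite[OF x] by blast
  next
    fix f assume f: "(\<forall>n. f n \<in> component M n) \<and> finite {n. f n \<noteq> \<zero>\<^bsub>M\<^esub>} \<and>
        x = finsum M f {n. f n \<noteq> \<zero>\<^bsub>M\<^esub>}"
    show "f = (\<lambda>n. p n x)"
    proof
      fix m show "f m = p m x"
        using p_sum[of "{n. f n \<noteq> \<zero>\<^bsub>M\<^esub>}" f m] f by auto
    qed
  qed
  thus ?thesis unfolding graded_module_def using assms(1) comp smult by blast
qed

definition degree_part :: "('r, 'e, 'y) graded_module_scheme \<Rightarrow> int \<Rightarrow> 'e \<Rightarrow> 'e" where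
  "degree_part M n x = (THE f. (\<forall>n. f n \<in> component M n) \<and> finite {n. f n \<noteq> \<zero>\<^bsub>M\<^esub>} \<and>
        x = finsum M f {n. f n \<noteq> \<zero>\<^bsub>M\<^esub>}) n"

locale graded =
  fixes S :: "('r, 'r, 'x) graded_module_scheme"
    and M :: "('r, 'e, 'y) graded_module_scheme"
  assumes graded_module: "graded_module S M"

sublocale graded \<subseteq> module S M
  using graded_module unfolding graded_module_def by blast

context graded
begin

lemma component_subgroup: "subgroup (component M n) (add_monoid M)"
  using graded_module unfolding graded_module_def by blast

lemma component_carrier: "x \<in> component M n \<Longrightarrow> x \<in> carrier M"
  using subgroup.subset[OF component_subgroup[of n]] by auto

lemma zero_component [simp]: "\<zero>\<^bsub>M\<^esub> \<in> component M n"
  using subgroup.one_closed[OF component_subgroup[of n]] by simp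

lemma add_component: "x \<in> component M n \<Longrightarrow> y \<in> component M n \<Longrightarrow> x \<oplus>\<^bsub>M\<^esub> y \<in> component M n"
  using subgroup.m_closed[OF component_subgroup[of n]] by simp

lemma minus_component: "x \<in> component M n \<Longrightarrow> \<ominus>\<^bsub>M\<^esub> x \<in> component M n"
  using subgroup.m_inv_closed[OF component_subgroup[of n]] by (simp add: a_inv_def)

lemma smult_component:
  "r \<in> component S k \<Longrightarrow> x \<in> component M n \<Longrightarrow> r \<odot>\<^bsub>M\<^esub> x \<in> component M (k + n)"
  using graded_module unfolding graded_module_def by blast

lemma decomposition_ex1:
  assumes "x \<in> carrier M"
  shows "\<exists>!f. (\<forall>n. f n \<in> component M n) \<and> finite {n. f n \<noteq> \<zero>\<^bsub>M\<^esub>} \<and>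
        x = finsum M f {n. f n \<noteq> \<zero>\<^bsub>M\<^esub>}"
  using graded_module assms unfolding graded_module_def by blast

lemma degree_part_decomposition:
  assumes "x \<in> carrier M"
  shows "degree_part M n x \<in> component M n" "finite {n. degree_part M n x \<noteq> \<zero>\<^bsub>M\<^esub>}"
    "x = finsum M (\<lambda>n. degree_part M n x) {n. degree_part M n x \<noteq> \<zero>\<^bsub>M\<^esub>}"
  using theI'[OF decomposition_ex1[OF assms]] unfolding degree_part_def by auto

lemma degree_part_carrier [simp]: "x \<in> carrier M \<Longrightarrow> degree_part M n x \<in> carrier M"
  using degree_part_decomposition(1) component_carrier by blast

lemma degree_part_unique:
  assumes f: "\<And>n. f n \<in> component M n" and "finite F" and F: "\<And>n. n \<notin> F \<Longrightarrow> f n = \<zero>\<^bsub>M\<^esub>"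
    and x: "x = finsum M f F"
  shows "degree_part M n x = f n"
proof -
  have fc: "f n \<in> carrier M" for n using f component_carrier by blast
  have "finite {n. f n \<noteq> \<zero>\<^bsub>M\<^esub>}"
    using F \<open>finite F\<close> by (metis (mono_tags, lifting) finite_subset mem_Collect_eq subsetI)
  moreover have "x = finsum M f {n. f n \<noteq> \<zero>\<^bsub>M\<^esub>}"
    unfolding x by (rule M.add.finprod_mono_neutral_cong) (use F fc \<open>finite F\<close> calculation in auto)
  moreover have "x \<in> carrier M" unfolding x using fc by (simp add: M.finsum_closed)
  ultimately show ?thesis
    using f the1_equality[OF decomposition_ex1, of x f] unfolding degree_part_def by auto
qed

lemma degree_part_id: "x \<in> component M n \<Longrightarrow> degree_part M n x = x"
  and degree_part_other: "x \<in> component M n \<Longrightarrow> m \<noteq> n \<Longrightarrow> degree_part M m x = \<zero>\<^bsub>M\<^esub>"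
proof -
  have "degree_part M m x = (if m = n then x else \<zero>\<^bsub>M\<^esub>)" if "x \<in> component M n" for m
    using that component_carrier[OF that]
    by (intro degree_part_unique[where F = "{n}"]) (auto simp: Pi_def)
  thus "x \<in> component M n \<Longrightarrow> degree_part M n x = x"
    "x \<in> component M n \<Longrightarrow> m \<noteq> n \<Longrightarrow> degree_part M m x = \<zero>\<^bsub>M\<^esub>" by auto
qed

lemma degree_part_zero [simp]: "degree_part M n \<zero>\<^bsub>M\<^esub> = \<zero>\<^bsub>M\<^esub>"
  by (simp add: degree_part_id)

lemma degree_part_add:
  assumes "x \<in> carrier M" "y \<in> carrier M"
  shows "degree_part M n (x \<oplus>\<^bsub>M\<^esub> y) = degree_part M n x \<oplus>\<^bsub>M\<^esub> degree_part M n y"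
proof (rule degree_part_unique)
  let ?F = "{n. degree_part M n x \<noteq> \<zero>\<^bsub>M\<^esub>} \<union> {n. degree_part M n y \<noteq> \<zero>\<^bsub>M\<^esub>}"
  show "finite ?F" using assms degree_part_decomposition by simp
  have "x = (\<Oplus>\<^bsub>M\<^esub>n\<in>?F. degree_part M n x)" "y = (\<Oplus>\<^bsub>M\<^esub>n\<in>?F. degree_part M n y)"
    by (subst degree_part_decomposition(3)[OF assms(1)] degree_part_decomposition(3)[OF assms(2)],
        rule M.add.finprod_mono_neutral_cong; use assms degree_part_decomposition in auto)+
  thus "x \<oplus>\<^bsub>M\<^esub> y = (\<Oplus>\<^bsub>M\<^esub>n\<in>?F. degree_part M n x \<oplus>\<^bsub>M\<^esub> degree_part M n y)"
    using assms by (subst M.finsum_addf) auto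
qed (use assms in \<open>auto simp: add_component degree_part_decomposition\<close>)

lemma degree_part_separate:
  assumes "x \<in> carrier M" "\<And>n. degree_part M n x = \<zero>\<^bsub>M\<^esub>"
  shows "x = \<zero>\<^bsub>M\<^esub>"
  using degree_part_decomposition(3)[OF assms(1)] assms(2) by simp

lemma degree_part_induct [consumes 1, case_names degree_part zero add]:
  assumes "x \<in> carrier M" and "\<And>n. Q (degree_part M n x)" and "Q \<zero>\<^bsub>M\<^esub>"
    and add: "\<And>y z. y \<in> carrier M \<Longrightarrow> z \<in> carrier M \<Longrightarrow> Q y \<Longrightarrow> Q z \<Longrightarrow> Q (y \<oplus>\<^bsub>M\<^esub> z)"
  shows "Q x"
proof -
  have "Q (finsum M (\<lambda>n. degree_part M n x) F)" if "finite F" for F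
    using that by induction (use assms in \<open>auto simp: Pi_def M.finsum_closed\<close>)
  thus ?thesis
    using degree_part_decomposition[OF assms(1)] by metis
qed

lemma homogeneous_induct [consumes 1, case_names homogeneous add]:
  assumes "x \<in> carrier M" and hom: "\<And>n y. y \<in> component M n \<Longrightarrow> Q y"
    and "\<And>y z. y \<in> carrier M \<Longrightarrow> z \<in> carrier M \<Longrightarrow> Q y \<Longrightarrow> Q z \<Longrightarrow> Q (y \<oplus>\<^bsub>M\<^esub> z)"
  shows "Q x"
  by (rule degree_part_induct) (use assms hom[OF degree_part_decomposition(1)] hom[OF zero_component] in auto)

end

lemma (in graded) degree_part_eqI:
  assumes closed: "\<And>x. x \<in> carrier M \<Longrightarrow> p x \<in> carrier M"
    and add: "\<And>x y. x \<in> carrier M \<Longrightarrow> y \<in> carrier M \<Longrightarrow> p (x \<oplus>\<^bsub>M\<^esub> y) = p x \<oplus>\<^bsub>M\<^esub> p y"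
    and id: "\<And>x. x \<in> component M n \<Longrightarrow> p x = x"
    and other: "\<And>m x. x \<in> component M m \<Longrightarrow> m \<noteq> n \<Longrightarrow> p x = \<zero>\<^bsub>M\<^esub>"
    and x: "x \<in> carrier M"
  shows "degree_part M n x = p x"
  using x
proof (induction x rule: homogeneous_induct)
  case (homogeneous m y)
  thus ?case using id other degree_part_id degree_part_other by (cases "m = n") auto
qed (simp add: degree_part_add assms)

lemma (in abelian_group) add_diff_cancel_r:
  assumes "a \<in> carrier G" "b \<in> carrier G" "c \<in> carrier G"
  shows "(a \<oplus> b) \<ominus> (c \<oplus> b) = a \<ominus> c"
proof -
  have "(a \<oplus> b) \<ominus> (c \<oplus> b) = (a \<ominus> c) \<oplus> (b \<oplus> \<ominus> b)"
    using assms by (simp add: minus_eq minus_add a_ac del: r_neg)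
  thus ?thesis using assms by (simp add: r_neg)
qed

lemma (in abelian_group) add_diff_add:
  assumes "a \<in> carrier G" "b \<in> carrier G" "c \<in> carrier G" "d \<in> carrier G"
  shows "(a \<oplus> b) \<ominus> (c \<oplus> d) = (a \<ominus> c) \<oplus> (b \<ominus> d)"
  using assms by (simp add: minus_eq minus_add a_ac)

lemma (in abelian_group) minus_eq_zeroD:
  assumes "a \<in> carrier G" "b \<in> carrier G" "a \<ominus> b = \<zero>"
  shows "a = b"
proof -
  have "(a \<ominus> b) \<oplus> b = a" using assms(1,2) by (simp add: minus_eq a_assoc l_neg)
  thus ?thesis using assms by simp
qed

lemma additive_zero:
  assumes "abelian_group M" "abelian_group N" "h \<in> carrier M \<rightarrow> carrier N"
    and "\<And>x y. x \<in> carrier M \<Longrightarrow> y \<in> carrier M \<Longrightarrow> h (x \<oplus>\<^bsub>M\<^esub> y) = h x \<oplus>\<^bsub>N\<^esub> h y"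
  shows "h \<zero>\<^bsub>M\<^esub> = \<zero>\<^bsub>N\<^esub>"
proof -
  interpret M: abelian_group M by fact
  interpret N: abelian_group N by fact
  have "h \<zero>\<^bsub>M\<^esub> \<oplus>\<^bsub>N\<^esub> h \<zero>\<^bsub>M\<^esub> = h \<zero>\<^bsub>M\<^esub>"
    using assms(4)[of "\<zero>\<^bsub>M\<^esub>" "\<zero>\<^bsub>M\<^esub>"] by simp
  thus ?thesis using assms(3) by (metis M.zero_closed N.add.r_cancel_one' Pi_iff)
qed

lemma additive_minus:
  assumes "abelian_group M" "abelian_group N" "h \<in> carrier M \<rightarrow> carrier N"
    and "\<And>x y. x \<in> carrier M \<Longrightarrow> y \<in> carrier M \<Longrightarrow> h (x \<oplus>\<^bsub>M\<^esub> y) = h x \<oplus>\<^bsub>N\<^esub> h y"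
    and "x \<in> carrier M"
  shows "h (\<ominus>\<^bsub>M\<^esub> x) = \<ominus>\<^bsub>N\<^esub> h x"
proof -
  interpret M: abelian_group M by fact
  interpret N: abelian_group N by fact
  have z: "h \<zero>\<^bsub>M\<^esub> = \<zero>\<^bsub>N\<^esub>"
    by (rule additive_zero[OF assms(1-3)]) (rule assms(4))
  have "h (\<ominus>\<^bsub>M\<^esub> x) \<oplus>\<^bsub>N\<^esub> h x = \<zero>\<^bsub>N\<^esub>"
    using assms(4)[of "\<ominus>\<^bsub>M\<^esub> x" x] assms(5) z by (simp add: M.l_neg)
  moreover have "h x \<in> carrier N" "h (\<ominus>\<^bsub>M\<^esub> x) \<in> carrier N"
    using assms(3,5) by auto
  ultimately show ?thesis using N.minus_equality by simp
qed

text \<open>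
  Besides graded homomorphisms, this covers multiplication by a homogeneous scalar, which shifts
  degrees; hence the degree \<open>k\<close>.
\<close>

lemma degree_part_shift:
  assumes "graded S M" "graded S' N" and h: "h \<in> carrier M \<rightarrow> carrier N"
    and add: "\<And>x y. x \<in> carrier M \<Longrightarrow> y \<in> carrier M \<Longrightarrow> h (x \<oplus>\<^bsub>M\<^esub> y) = h x \<oplus>\<^bsub>N\<^esub> h y"
    and deg: "\<And>n x. x \<in> component M n \<Longrightarrow> h x \<in> component N (k + n)"
    and x: "x \<in> carrier M"
  shows "degree_part N (k + n) (h x) = h (degree_part M n x)"
proof -
  interpret M: graded S M by fact
  interpret N: graded S' N by fact
  show ?thesis
    using x
  proof (induction x rule: M.homogeneous_induct)
    case (homogeneous m x)
    show ?case
    proof (cases "m = n")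
      case True
      thus ?thesis using homogeneous deg by (simp add: M.degree_part_id N.degree_part_id)
    next
      case False
      have "h \<zero>\<^bsub>M\<^esub> = \<zero>\<^bsub>N\<^esub>"
        using additive_zero[OF M.abelian_group_axioms N.abelian_group_axioms h add] .
      thus ?thesis using False M.degree_part_other[OF homogeneous, of n]
          N.degree_part_other[OF deg[OF homogeneous], of "k + n"]
        by simp
    qed
  next
    case (add y z)
    note IH = add
    show ?case using IH h by (simp add: assms(4) M.degree_part_add N.degree_part_add Pi_iff)
  qed
qed

lemma (in graded) degree_part_smult:
  assumes "r \<in> component S k" "r \<in> carrier S" "x \<in> carrier M"
  shows "degree_part M (k + n) (r \<odot>\<^bsub>M\<^esub> x) = r \<odot>\<^bsub>M\<^esub> degree_part M n x"
  by (rule degree_part_shift[where h = "\<lambda>x. r \<odot>\<^bsub>M\<^esub> x"])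
    (use assms in \<open>auto simp: smult_r_distr smult_component intro: graded_axioms\<close>)

lemma submodule_image:
  assumes "module S M" "module S N" "h \<in> carrier M \<rightarrow> carrier N"
    and add: "\<And>x y. x \<in> carrier M \<Longrightarrow> y \<in> carrier M \<Longrightarrow> h (x \<oplus>\<^bsub>M\<^esub> y) = h x \<oplus>\<^bsub>N\<^esub> h y"
    and smult: "\<And>r x. r \<in> carrier S \<Longrightarrow> x \<in> carrier M \<Longrightarrow> h (r \<odot>\<^bsub>M\<^esub> x) = r \<odot>\<^bsub>N\<^esub> h x"
    and T: "submodule T S M"
  shows "submodule (h ` T) S N"
proof -
  interpret M: module S M by (rule assms(1))
  interpret N: module S N by (rule assms(2))
  note sub = M.submoduleE[OF T]
  have Tc: "x \<in> carrier M" if "x \<in> T" for x using sub(1) that by (rule subsetD)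
  have hc: "h x \<in> carrier N" if "x \<in> T" for x using Tc[OF that] assms(3) by (rule funcset_mem[rotated])
  have zero: "\<zero>\<^bsub>M\<^esub> \<in> T" using subgroup.one_closed[OF submodule.axioms(1)[OF T]] by simp
  show ?thesis
  proof (rule N.submoduleI)
    show "h ` T \<subseteq> carrier N" using hc by (rule image_subsetI)
    have "h \<zero>\<^bsub>M\<^esub> = \<zero>\<^bsub>N\<^esub>"
      by (rule additive_zero[OF M.abelian_group_axioms N.abelian_group_axioms assms(3) add])
    thus "\<zero>\<^bsub>N\<^esub> \<in> h ` T" using zero by (metis imageI)
  next
    fix y assume "y \<in> h ` T"
    then obtain x where x: "x \<in> T" "y = h x" by (elim imageE)
    have "h (\<ominus>\<^bsub>M\<^esub> x) = \<ominus>\<^bsub>N\<^esub> h x"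
      by (rule additive_minus[OF M.abelian_group_axioms N.abelian_group_axioms assms(3) add Tc[OF x(1)]])
    thus "\<ominus>\<^bsub>N\<^esub> y \<in> h ` T" using sub(3)[OF x(1)] x(2) by (metis imageI)
  next
    fix y z assume "y \<in> h ` T" "z \<in> h ` T"
    then obtain x x' where x: "x \<in> T" "y = h x" "x' \<in> T" "z = h x'" by (elim imageE)
    hence "y \<oplus>\<^bsub>N\<^esub> z = h (x \<oplus>\<^bsub>M\<^esub> x')" using add[OF Tc Tc] by simp
    thus "y \<oplus>\<^bsub>N\<^esub> z \<in> h ` T" using sub(5)[OF x(1,3)] by simp
  next
    fix r y assume r: "r \<in> carrier S" and "y \<in> h ` T"
    then obtain x where x: "x \<in> T" "y = h x" by (elim imageE)
    hence "r \<odot>\<^bsub>N\<^esub> y = h (r \<odot>\<^bsub>M\<^esub> x)" using smult[OF r Tc] by simp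
    thus "r \<odot>\<^bsub>N\<^esub> y \<in> h ` T" using sub(4)[OF r x(1)] by simp
  qed
qed

definition graded_submodule where
  "graded_submodule S M N \<longleftrightarrow> submodule N S M \<and> (\<forall>n. \<forall>x\<in>N. degree_part M n x \<in> N)"

lemma graded_module_restrict:
  fixes M :: "('r, 'e) graded_module"
  assumes "graded S M" "graded_submodule S M N" and S: "\<And>k. component S k \<subseteq> carrier S"
  shows "graded_module S (graded_restrict M N)"
proof -
  interpret M: graded S M by fact
  have N: "submodule N S M" and hN: "\<And>n x. x \<in> N \<Longrightarrow> degree_part M n x \<in> N"
    using assms(2) unfolding graded_submodule_def by auto
  note sub = M.submoduleE[OF N]
  have Nc: "x \<in> N \<Longrightarrow> x \<in> carrier M" for x using sub(1) by blast
  have zero: "\<zero>\<^bsub>M\<^esub> \<in> N" using subgroup.one_closed[OF submodule.axioms(1)[OF N]] by simp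
  show ?thesis
  proof (rule graded_moduleI[where p = "degree_part M"])
    show "module S (graded_restrict M N)"
    proof (rule moduleI)
      show "abelian_group (graded_restrict M N)"
      proof (rule abelian_groupI)
        fix x assume "x \<in> carrier (graded_restrict M N)"
        hence "x \<in> N" by (simp add: graded_restrict_def)
        thus "\<exists>y\<in>carrier (graded_restrict M N).
          y \<oplus>\<^bsub>graded_restrict M N\<^esub> x = \<zero>\<^bsub>graded_restrict M N\<^esub>"
          using sub(3)[of x] Nc M.M.l_neg by (auto simp: graded_restrict_def)
      qed (use sub(5) zero Nc in \<open>auto simp: graded_restrict_def M.M.a_ac\<close>)
    qed (use sub(4,5) Nc in \<open>auto simp: graded_restrict_def M.smult_l_distr M.smult_r_distr
        M.smult_assoc1 M.is_cring\<close>)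
  next
    fix n x assume "x \<in> component (graded_restrict M N) n"
    hence "x \<in> component M n" "x \<in> N" by (auto simp: graded_restrict_def)
    thus "\<exists>y\<in>component (graded_restrict M N) n.
        y \<oplus>\<^bsub>graded_restrict M N\<^esub> x = \<zero>\<^bsub>graded_restrict M N\<^esub>"
      using sub(3)[of x] Nc M.minus_component[of x n] M.M.l_neg by (auto simp: graded_restrict_def)
  next
    fix k n r x assume "r \<in> component S k" "x \<in> component (graded_restrict M N) n"
    thus "r \<odot>\<^bsub>graded_restrict M N\<^esub> x \<in> component (graded_restrict M N) (k + n)"
      using M.smult_component[of r k x n] sub(4)[of r x] S[of k] by (auto simp: graded_restrict_def)
  next
    fix x assume "x \<in> carrier (graded_restrict M N)"
      "\<And>n. degree_part M n x = \<zero>\<^bsub>graded_restrict M N\<^esub>"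
    thus "x = \<zero>\<^bsub>graded_restrict M N\<^esub>"
      using M.degree_part_separate[of x] Nc by (simp add: graded_restrict_def)
  next
    fix m n x assume "x \<in> component (graded_restrict M N) n" "m \<noteq> n"
    thus "degree_part M m x = \<zero>\<^bsub>graded_restrict M N\<^esub>"
      using M.degree_part_other[of x n m] by (simp add: graded_restrict_def)
  qed (use sub(5) zero Nc hN in \<open>auto simp: graded_restrict_def M.add_component
        M.degree_part_decomposition(1,2) M.degree_part_add M.degree_part_id\<close>)
qed

lemma graded_homI:
  assumes "\<And>x. x \<in> carrier M \<Longrightarrow> h x \<in> carrier N"
    and "\<And>x y. x \<in> carrier M \<Longrightarrow> y \<in> carrier M \<Longrightarrow> h (x \<oplus>\<^bsub>M\<^esub> y) = h x \<oplus>\<^bsub>N\<^esub> h y"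
    and "\<And>r x. r \<in> carrier S \<Longrightarrow> x \<in> carrier M \<Longrightarrow> h (r \<odot>\<^bsub>M\<^esub> x) = r \<odot>\<^bsub>N\<^esub> h x"
    and "\<And>n x. x \<in> component M n \<Longrightarrow> h x \<in> component N n"
  shows "h \<in> graded_hom S M N"
  using assms unfolding graded_hom_def by blast

lemma graded_homD:
  assumes "h \<in> graded_hom S M N"
  shows "x \<in> carrier M \<Longrightarrow> h x \<in> carrier N"
    and "x \<in> carrier M \<Longrightarrow> y \<in> carrier M \<Longrightarrow> h (x \<oplus>\<^bsub>M\<^esub> y) = h x \<oplus>\<^bsub>N\<^esub> h y"
    and "r \<in> carrier S \<Longrightarrow> x \<in> carrier M \<Longrightarrow> h (r \<odot>\<^bsub>M\<^esub> x) = r \<odot>\<^bsub>N\<^esub> h x"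
    and "x \<in> component M n \<Longrightarrow> h x \<in> component N n"
  using assms unfolding graded_hom_def by blast+

lemma graded_hom_compose:
  assumes "h \<in> graded_hom S L M" "k \<in> graded_hom S M N"
  shows "k \<circ> h \<in> graded_hom S L N"
  using graded_homD[OF assms(1)] graded_homD[OF assms(2)] by (intro graded_homI) auto

section \<open>Injectivity on other carrier types\<close>

definition transport :: "('e \<Rightarrow> 'u) \<Rightarrow> ('r, 'e) graded_module \<Rightarrow> ('r, 'u) graded_module" where
  "transport g M =
     \<lparr>carrier = g ` carrier M, monoid.mult = undefined, one = undefined, zero = g \<zero>\<^bsub>M\<^esub>,
      add = (\<lambda>x y. g (inv_into UNIV g x \<oplus>\<^bsub>M\<^esub> inv_into UNIV g y)),
      module.smult = (\<lambda>r x. g (r \<odot>\<^bsub>M\<^esub> inv_into UNIV g x)),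
      component = (\<lambda>n. g ` component M n)\<rparr>"

lemma graded_module_transport:
  assumes "graded S M" "inj g"
  shows "graded_module S (transport g M)"
proof -
  interpret M: graded S M by fact
  note [simp] = inv_f_f[OF assms(2)] inj_image_mem_iff[OF assms(2)] inj_eq[OF assms(2)]
  show ?thesis
  proof (rule graded_moduleI[where p = "\<lambda>n x. g (degree_part M n (inv_into UNIV g x))"])
    show "module S (transport g M)"
    proof (rule moduleI)
      show "abelian_group (transport g M)"
      proof (rule abelian_groupI)
        fix x assume "x \<in> carrier (transport g M)"
        then obtain x' where "x = g x'" "x' \<in> carrier M" by (auto simp: transport_def)
        thus "\<exists>y\<in>carrier (transport g M). y \<oplus>\<^bsub>transport g M\<^esub> x = \<zero>\<^bsub>transport g M\<^esub>"
          by (intro bexI[of _ "g (\<ominus>\<^bsub>M\<^esub> x')"]) (simp_all add: transport_def M.M.l_neg)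
      qed (auto simp: transport_def M.M.a_ac)
    qed (auto simp: transport_def M.smult_l_distr M.smult_r_distr M.smult_assoc1 M.is_cring)
  next
    fix n x assume "x \<in> component (transport g M) n"
    then obtain x' where "x = g x'" "x' \<in> component M n" by (auto simp: transport_def)
    thus "\<exists>y\<in>component (transport g M) n. y \<oplus>\<^bsub>transport g M\<^esub> x = \<zero>\<^bsub>transport g M\<^esub>"
      using M.component_carrier[of x' n]
      by (intro bexI[of _ "g (\<ominus>\<^bsub>M\<^esub> x')"]) (simp_all add: transport_def M.M.l_neg M.minus_component)
  next
    fix x assume "x \<in> carrier (transport g M)"
      "\<And>n. g (degree_part M n (inv_into UNIV g x)) = \<zero>\<^bsub>transport g M\<^esub>"
    thus "x = \<zero>\<^bsub>transport g M\<^esub>"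
      using M.degree_part_separate by (auto simp: transport_def)
  next
    fix m n x assume "x \<in> component (transport g M) n" "m \<noteq> n"
    thus "g (degree_part M m (inv_into UNIV g x)) = \<zero>\<^bsub>transport g M\<^esub>"
      using M.degree_part_other by (auto simp: transport_def)
  qed (auto simp: transport_def M.add_component M.smult_component 
        M.degree_part_decomposition(1,2) M.degree_part_add M.degree_part_id intro: M.component_carrier)
qed

lemma transport_graded_hom:
  assumes "inj g"
  shows "g \<in> graded_hom S M (transport g M)"
    and "inv_into UNIV g \<in> graded_hom S (transport g M) M"
  using assms by (auto intro!: graded_homI simp: transport_def)

text \<open>
  The test modules in the definition of injectivity live on a single type. Copying along an injection
  moves the test to any type that embeds into that one, in particular to \<open>'e \<times> 'e\<close>, on which the
  module of jets below lives.
\<close>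

lemma graded_injectiveD:
  fixes g :: "'f \<Rightarrow> 'u" and N N' :: "('r, 'f) graded_module"
  assumes inj: "graded_injective TYPE('u) S E" and g: "inj g"
    and N: "graded S N" "graded S N'"
    and j: "j \<in> graded_hom S N N'" "inj_on j (carrier N)" and \<phi>: "\<phi> \<in> graded_hom S N E"
  obtains \<psi> where "\<psi> \<in> graded_hom S N' E" "\<And>x. x \<in> carrier N \<Longrightarrow> \<psi> (j x) = \<phi> x"
proof -
  note hom = transport_graded_hom[OF g] graded_hom_compose
  have 1: "g \<circ> (j \<circ> inv_into UNIV g) \<in> graded_hom S (transport g N) (transport g N')"
    using hom j(1) by metis
  have 2: "inj_on (g \<circ> (j \<circ> inv_into UNIV g)) (carrier (transport g N))"
    using j(2) g by (auto simp: inj_on_def transport_def)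
  have 3: "\<phi> \<circ> inv_into UNIV g \<in> graded_hom S (transport g N) E"
    using hom \<phi> by metis
  obtain \<psi> where \<psi>: "\<psi> \<in> graded_hom S (transport g N') E"
    "\<forall>x\<in>carrier (transport g N). \<psi> ((g \<circ> (j \<circ> inv_into UNIV g)) x) = (\<phi> \<circ> inv_into UNIV g) x"
    using inj[unfolded graded_injective_def, rule_format, OF graded_module_transport[OF N(1) g]
        graded_module_transport[OF N(2) g] 1 2 3] by blast
  show ?thesis
  proof (rule that[of "\<psi> \<circ> g"])
    show "\<psi> \<circ> g \<in> graded_hom S N' E" using hom \<psi>(1) by metis
  next
    fix x assume "x \<in> carrier N"
    thus "(\<psi> \<circ> g) (j x) = \<phi> x" using \<psi>(2) g by (auto simp: transport_def)
  qed
qed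

section \<open>Derivations, jets and connections\<close>

locale graded_derivation =
  fixes S :: "('r, 'r) graded_module" and \<delta> :: "'r \<Rightarrow> 'r"
  assumes cring: "cring S"
    and component_subset: "component S k \<subseteq> carrier S"
    and closed: "r \<in> carrier S \<Longrightarrow> \<delta> r \<in> carrier S"
    and additive: "r \<in> carrier S \<Longrightarrow> s \<in> carrier S \<Longrightarrow> \<delta> (r \<oplus>\<^bsub>S\<^esub> s) = \<delta> r \<oplus>\<^bsub>S\<^esub> \<delta> s"
    and Leibniz: "r \<in> carrier S \<Longrightarrow> s \<in> carrier S \<Longrightarrow>
      \<delta> (r \<otimes>\<^bsub>S\<^esub> s) = r \<otimes>\<^bsub>S\<^esub> \<delta> s \<oplus>\<^bsub>S\<^esub> \<delta> r \<otimes>\<^bsub>S\<^esub> s"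
    and degree: "r \<in> component S k \<Longrightarrow> \<delta> r \<in> component S (k - 1)"
begin

sublocale cring S by (rule cring)

lemma derivation_one: "\<delta> \<one>\<^bsub>S\<^esub> = \<zero>\<^bsub>S\<^esub>"
proof -
  have "\<delta> \<one>\<^bsub>S\<^esub> \<oplus>\<^bsub>S\<^esub> \<delta> \<one>\<^bsub>S\<^esub> = \<delta> \<one>\<^bsub>S\<^esub>"
    using Leibniz[of "\<one>\<^bsub>S\<^esub>" "\<one>\<^bsub>S\<^esub>"] closed by simp
  thus ?thesis using closed by (simp add: add.r_cancel_one)
qed

text \<open>
  The first jets of \<open>M\<close> along \<open>\<delta>\<close>: the extension of \<open>M\<close> by \<open>M\<close> whose scalar multiplication
  is twisted by \<open>\<delta>\<close>, so that \<open>x \<mapsto> (x, D x)\<close> is linear iff \<open>D (r x) = r (D x) + (\<delta> r) x\<close>.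
  The shift by one in the first factor makes this map homogeneous for \<open>D\<close> of degree \<open>-1\<close> and keeps
  the embedding \<open>y \<mapsto> (0, y)\<close> of degree \<open>0\<close>, as graded injectivity requires.
\<close>

definition jet_module :: "('r, 'e) graded_module \<Rightarrow> ('r, 'e \<times> 'e) graded_module" where
  "jet_module M =
     \<lparr>carrier = carrier M \<times> carrier M, monoid.mult = undefined, one = undefined,
      zero = (\<zero>\<^bsub>M\<^esub>, \<zero>\<^bsub>M\<^esub>), add = (\<lambda>z w. (fst z \<oplus>\<^bsub>M\<^esub> fst w, snd z \<oplus>\<^bsub>M\<^esub> snd w)),
      module.smult = (\<lambda>r z. (r \<odot>\<^bsub>M\<^esub> fst z, r \<odot>\<^bsub>M\<^esub> snd z \<oplus>\<^bsub>M\<^esub> \<delta> r \<odot>\<^bsub>M\<^esub> fst z)),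
      component = (\<lambda>n. component M (n + 1) \<times> component M n)\<rparr>"

lemma graded_module_jet:
  assumes "graded S M"
  shows "graded_module S (jet_module M)"
proof -
  interpret M: graded S M by fact
  note [simp] = jet_module_def
  note [intro] = M.component_carrier
  show ?thesis
  proof (rule graded_moduleI[where p = "\<lambda>n z. (degree_part M (n + 1) (fst z), degree_part M n (snd z))"])
    show "module S (jet_module M)"
    proof (rule moduleI)
      show "abelian_group (jet_module M)"
      proof (rule abelian_groupI)
        fix z assume "z \<in> carrier (jet_module M)"
        thus "\<exists>w\<in>carrier (jet_module M). w \<oplus>\<^bsub>jet_module M\<^esub> z = \<zero>\<^bsub>jet_module M\<^esub>"
          by (intro bexI[of _ "(\<ominus>\<^bsub>M\<^esub> fst z, \<ominus>\<^bsub>M\<^esub> snd z)"]) (auto simp: M.M.l_neg)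
      qed (auto simp: M.M.a_ac)
    next
      fix r s z assume rs: "r \<in> carrier S" "s \<in> carrier S" and "z \<in> carrier (jet_module M)"
      hence z: "fst z \<in> carrier M" "snd z \<in> carrier M" by auto
      show "(r \<oplus>\<^bsub>S\<^esub> s) \<odot>\<^bsub>jet_module M\<^esub> z
          = r \<odot>\<^bsub>jet_module M\<^esub> z \<oplus>\<^bsub>jet_module M\<^esub> s \<odot>\<^bsub>jet_module M\<^esub> z"
        using rs z closed by (simp add: additive M.smult_l_distr M.M.a_ac)
      show "(r \<otimes>\<^bsub>S\<^esub> s) \<odot>\<^bsub>jet_module M\<^esub> z = r \<odot>\<^bsub>jet_module M\<^esub> (s \<odot>\<^bsub>jet_module M\<^esub> z)"
        using rs z closed
        by (simp add: Leibniz M.smult_l_distr M.smult_r_distr M.smult_assoc1 M.M.a_ac)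
    qed (auto simp: M.smult_r_distr M.M.a_ac derivation_one closed cring)
  next
    fix n z assume "z \<in> component (jet_module M) n"
    thus "\<exists>w\<in>component (jet_module M) n. w \<oplus>\<^bsub>jet_module M\<^esub> z = \<zero>\<^bsub>jet_module M\<^esub>"
      by (intro bexI[of _ "(\<ominus>\<^bsub>M\<^esub> fst z, \<ominus>\<^bsub>M\<^esub> snd z)"])
        (auto simp: M.minus_component intro!: M.M.l_neg)
  next
    fix k n r z assume "r \<in> component S k" "z \<in> component (jet_module M) n"
    thus "r \<odot>\<^bsub>jet_module M\<^esub> z \<in> component (jet_module M) (k + n)"
      using M.smult_component[of r k "fst z" "n + 1"] M.smult_component[of r k "snd z" n]
        M.smult_component[OF degree, of r k "fst z" "n + 1"]
      by (auto simp: add.assoc intro!: M.add_component)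
  next
    fix z assume "z \<in> carrier (jet_module M)"
    hence "finite {n. degree_part M n (fst z) \<noteq> \<zero>\<^bsub>M\<^esub>}" and 2: "finite {n. degree_part M n (snd z) \<noteq> \<zero>\<^bsub>M\<^esub>}"
      using M.degree_part_decomposition(2) by auto
    from finite_vimageI[OF this(1), of "\<lambda>n. n + 1"]
    have "finite {n. degree_part M (n + 1) (fst z) \<noteq> \<zero>\<^bsub>M\<^esub>}" by (simp add: vimage_def)
    with 2 have "finite ({n. degree_part M (n + 1) (fst z) \<noteq> \<zero>\<^bsub>M\<^esub>} \<union> {n. degree_part M n (snd z) \<noteq> \<zero>\<^bsub>M\<^esub>})"
      by simp
    thus "finite {n. (degree_part M (n + 1) (fst z), degree_part M n (snd z)) \<noteq> \<zero>\<^bsub>jet_module M\<^esub>}"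
      by (rule rev_finite_subset) auto
  next
    fix z assume z: "z \<in> carrier (jet_module M)"
      and 0: "\<And>n. (degree_part M (n + 1) (fst z), degree_part M n (snd z)) = \<zero>\<^bsub>jet_module M\<^esub>"
    have "degree_part M n (fst z) = \<zero>\<^bsub>M\<^esub>" "degree_part M n (snd z) = \<zero>\<^bsub>M\<^esub>" for n
      using 0[of "n - 1"] 0[of n] by auto
    thus "z = \<zero>\<^bsub>jet_module M\<^esub>"
      using z M.degree_part_separate[of "fst z"] M.degree_part_separate[of "snd z"] by (auto simp: prod_eq_iff)
  next
    fix m n z assume "z \<in> component (jet_module M) n" "m \<noteq> n"
    thus "(degree_part M (m + 1) (fst z), degree_part M m (snd z)) = \<zero>\<^bsub>jet_module M\<^esub>"
      using M.degree_part_other[of "fst z" "n + 1" "m + 1"] M.degree_part_other[of "snd z" n m] by auto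
  qed (auto simp: M.add_component M.degree_part_decomposition(1) M.degree_part_add M.degree_part_id)
qed

lemma degree_part_jet:
  assumes "graded S M" "z \<in> carrier (jet_module M)"
  shows "degree_part (jet_module M) n z = (degree_part M (n + 1) (fst z), degree_part M n (snd z))"
proof -
  interpret M: graded S M by fact
  interpret J: graded S "jet_module M" by standard (rule graded_module_jet[OF assms(1)])
  show ?thesis
  proof (rule J.degree_part_eqI[OF _ _ _ _ assms(2)])
    fix m z assume "z \<in> component (jet_module M) m" "m \<noteq> n"
    thus "(degree_part M (n + 1) (fst z), degree_part M n (snd z)) = \<zero>\<^bsub>jet_module M\<^esub>"
      using M.degree_part_other[of "fst z" "m + 1" "n + 1"] M.degree_part_other[of "snd z" m n]
      by (auto simp: jet_module_def)
  qed (auto simp: jet_module_def M.degree_part_add M.degree_part_id)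
qed

text \<open>
  A lift of \<open>\<delta>\<close> to \<open>M\<close>: in geometric terms, a covariant derivative along the vector field \<open>\<delta>\<close>.
\<close>

definition connection :: "('r, 'e, 'y) graded_module_scheme \<Rightarrow> ('e \<Rightarrow> 'e) \<Rightarrow> bool" where
  "connection M D \<longleftrightarrow>
     D \<in> carrier M \<rightarrow> carrier M \<and>
     (\<forall>x\<in>carrier M. \<forall>y\<in>carrier M. D (x \<oplus>\<^bsub>M\<^esub> y) = D x \<oplus>\<^bsub>M\<^esub> D y) \<and>
     (\<forall>r\<in>carrier S. \<forall>x\<in>carrier M. D (r \<odot>\<^bsub>M\<^esub> x) = r \<odot>\<^bsub>M\<^esub> D x \<oplus>\<^bsub>M\<^esub> \<delta> r \<odot>\<^bsub>M\<^esub> x) \<and>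
     (\<forall>n. D ` component M n \<subseteq> component M (n - 1))"

lemma connectionI:
  assumes "\<And>x. x \<in> carrier M \<Longrightarrow> D x \<in> carrier M"
    and "\<And>x y. x \<in> carrier M \<Longrightarrow> y \<in> carrier M \<Longrightarrow> D (x \<oplus>\<^bsub>M\<^esub> y) = D x \<oplus>\<^bsub>M\<^esub> D y"
    and "\<And>r x. r \<in> carrier S \<Longrightarrow> x \<in> carrier M \<Longrightarrow> D (r \<odot>\<^bsub>M\<^esub> x) = r \<odot>\<^bsub>M\<^esub> D x \<oplus>\<^bsub>M\<^esub> \<delta> r \<odot>\<^bsub>M\<^esub> x"
    and "\<And>n x. x \<in> component M n \<Longrightarrow> D x \<in> component M (n - 1)"
  shows "connection M D"
  using assms unfolding connection_def by blast

lemma connectionD: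
  assumes "connection M D"
  shows "x \<in> carrier M \<Longrightarrow> D x \<in> carrier M"
    and "x \<in> carrier M \<Longrightarrow> y \<in> carrier M \<Longrightarrow> D (x \<oplus>\<^bsub>M\<^esub> y) = D x \<oplus>\<^bsub>M\<^esub> D y"
    and "r \<in> carrier S \<Longrightarrow> x \<in> carrier M \<Longrightarrow> D (r \<odot>\<^bsub>M\<^esub> x) = r \<odot>\<^bsub>M\<^esub> D x \<oplus>\<^bsub>M\<^esub> \<delta> r \<odot>\<^bsub>M\<^esub> x"
    and "x \<in> component M n \<Longrightarrow> D x \<in> component M (n - 1)"
  using assms unfolding connection_def by blast+

end

text \<open>
  An injective module carries a connection because the jet extension splits. One use of injectivity
  gives both the splitting and the compatibility with \<open>f\<close>: inside the jets of \<open>E\<close> consider the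
  submodule \<open>f(L) \<times> E\<close> and on it the map \<open>\<phi>(f x, y) = y - f (D x)\<close>. It is well defined because \<open>D\<close>
  preserves the kernel of \<open>f\<close>, and linear because the twisted term \<open>(\<delta> r) (f x)\<close> of the scalar
  multiplication cancels against the Leibniz term of \<open>D\<close>. If \<open>\<psi>\<close> extends \<open>\<phi>\<close> to all jets, then
  \<open>z \<mapsto> -\<psi>(z, 0)\<close> is the connection: \<open>\<psi>(0, y) = y\<close> yields the Leibniz rule, and
  \<open>\<psi>(f x, 0) = -f (D x)\<close> the compatibility.
\<close>

lemma (in graded_derivation) extend_connection:
  fixes g :: "'e \<times> 'e \<Rightarrow> 'u" and E :: "('r, 'e) graded_module"
    and L :: "('r, 'l, 'y) graded_module_scheme"
  assumes g: "inj g" and L: "graded S L" and E: "graded S E"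
    and inj: "graded_injective TYPE('u) S E"
    and f: "f \<in> graded_hom S L E" and D: "connection L D"
    and ker: "\<And>x. x \<in> carrier L \<Longrightarrow> f x = \<zero>\<^bsub>E\<^esub> \<Longrightarrow> f (D x) = \<zero>\<^bsub>E\<^esub>"
  obtains D' where "connection E D'" "\<And>x. x \<in> carrier L \<Longrightarrow> D' (f x) = f (D x)"
proof -
  interpret L: graded S L by fact
  interpret E: graded S E by fact
  interpret J: graded S "jet_module E" by standard (rule graded_module_jet[OF E])
  note fD = graded_homD[OF f] and DD = connectionD[OF D]
  have minus: "f (x \<ominus>\<^bsub>L\<^esub> y) = f x \<ominus>\<^bsub>E\<^esub> f y" "D (x \<ominus>\<^bsub>L\<^esub> y) = D x \<ominus>\<^bsub>L\<^esub> D y"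
    if "x \<in> carrier L" "y \<in> carrier L" for x y
    using that fD(1,2) DD(1,2) additive_minus[OF L.abelian_group_axioms E.abelian_group_axioms, of f y]
      additive_minus[OF L.abelian_group_axioms L.abelian_group_axioms, of D y]
    by (simp_all add: L.minus_eq E.minus_eq)
  have fD_cong: "f (D x) = f (D y)" if "x \<in> carrier L" "y \<in> carrier L" "f x = f y" for x y
  proof -
    have "f (x \<ominus>\<^bsub>L\<^esub> y) = \<zero>\<^bsub>E\<^esub>" using that fD(1) by (simp add: minus E.M.r_neg E.minus_eq)
    hence "f (D x) \<ominus>\<^bsub>E\<^esub> f (D y) = \<zero>\<^bsub>E\<^esub>"
      using ker[of "x \<ominus>\<^bsub>L\<^esub> y"] that DD(1) by (simp add: minus)
    thus ?thesis using that fD(1) DD(1) E.M.minus_eq_zeroD by simp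
  qed
  define u where "u y = f (D (SOME x. x \<in> carrier L \<and> f x = y))" for y
  have u: "u (f x) = f (D x)" if "x \<in> carrier L" for x
  proof -
    have "\<exists>x'. x' \<in> carrier L \<and> f x' = f x" using that by blast
    from someI_ex[OF this] show ?thesis unfolding u_def using that fD_cong by blast
  qed
  \<comment> \<open>the submodule \<open>f(L) \<times> E\<close> of the jets and the map \<open>\<phi>\<close> to be extended; \<open>u\<close> is \<open>f x \<mapsto> f (D x)\<close>\<close>
  define N where "N = f ` carrier L \<times> carrier E"
  define \<phi> where "\<phi> z = snd z \<ominus>\<^bsub>E\<^esub> u (fst z)" for z
  let ?N = "graded_restrict (jet_module E) N"
  have f0: "f \<zero>\<^bsub>L\<^esub> = \<zero>\<^bsub>E\<^esub>"
    by (rule additive_zero[OF L.abelian_group_axioms E.abelian_group_axioms]) (use fD in auto)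
  have f_neg: "f (\<ominus>\<^bsub>L\<^esub> x) = \<ominus>\<^bsub>E\<^esub> f x" if "x \<in> carrier L" for x
    by (rule additive_minus[OF L.abelian_group_axioms E.abelian_group_axioms])
      (simp_all add: fD(1,2) that)
  have f_degree_part: "degree_part E n (f x) = f (degree_part L n x)" if "x \<in> carrier L" for x n
  proof -
    have "degree_part E (0 + n) (f x) = f (degree_part L n x)"
      by (rule degree_part_shift[OF L E]) (simp_all add: fD(1,2) fD(4) that)
    thus ?thesis by simp
  qed
  have u_component: "u y \<in> component E (n - 1)" if y: "y \<in> component E n" "y \<in> f ` carrier L" for y n
  proof -
    obtain x where x: "x \<in> carrier L" "y = f x" using y(2) by blast
    have "f (degree_part L n x) = degree_part E n (f x)" by (rule f_degree_part[OF x(1), symmetric])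
    also have "\<dots> = y" unfolding x(2)[symmetric] by (rule E.degree_part_id[OF y(1)])
    finally have "y = f (degree_part L n x)" by (rule sym)
    hence "u y = f (D (degree_part L n x))" using u x(1) by simp
    thus ?thesis using fD(4)[OF DD(4)[OF L.degree_part_decomposition(1)[OF x(1)]]] by simp
  qed
  have N: "graded S ?N"
  proof (standard, rule graded_module_restrict[OF J.graded_axioms _ component_subset])
    have "submodule N S (jet_module E)"
    proof (rule J.submoduleI)
      fix z assume z: "z \<in> N"
      hence "(\<ominus>\<^bsub>E\<^esub> fst z, \<ominus>\<^bsub>E\<^esub> snd z) \<oplus>\<^bsub>jet_module E\<^esub> z = \<zero>\<^bsub>jet_module E\<^esub>"
        using fD(1) by (auto simp: N_def jet_module_def E.M.l_neg)
      moreover have "(\<ominus>\<^bsub>E\<^esub> fst z, \<ominus>\<^bsub>E\<^esub> snd z) \<in> N"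
        using z by (auto simp: N_def f_neg[symmetric])
      ultimately show "\<ominus>\<^bsub>jet_module E\<^esub> z \<in> N"
        using z fD(1) J.minus_equality[of "(\<ominus>\<^bsub>E\<^esub> fst z, \<ominus>\<^bsub>E\<^esub> snd z)" z]
        by (auto simp: N_def jet_module_def)
    qed (use fD(1) f0 in \<open>auto simp: N_def jet_module_def closed fD(2,3)[symmetric] intro: rev_image_eqI\<close>)
    moreover have "degree_part (jet_module E) n z \<in> N" if "z \<in> N" for n z
      using that fD(1) degree_part_jet[OF E, of z n] by (auto simp: N_def jet_module_def f_degree_part)
    ultimately show "graded_submodule S (jet_module E) N" unfolding graded_submodule_def by blast
  qed
  have incl: "(\<lambda>z. z) \<in> graded_hom S ?N (jet_module E)"
    using fD(1) by (intro graded_homI) (auto simp: graded_restrict_def N_def jet_module_def)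
  have \<phi>: "\<phi> \<in> graded_hom S ?N E"
  proof (rule graded_homI)
    fix z assume "z \<in> carrier ?N"
    thus "\<phi> z \<in> carrier E"
      using u fD(1) DD(1) by (auto simp: \<phi>_def graded_restrict_def N_def)
  next
    fix z w assume "z \<in> carrier ?N" "w \<in> carrier ?N"
    then obtain x x' where x: "x \<in> carrier L" "fst z = f x" "snd z \<in> carrier E"
      "x' \<in> carrier L" "fst w = f x'" "snd w \<in> carrier E"
      by (auto simp: graded_restrict_def N_def)
    have "u (f x \<oplus>\<^bsub>E\<^esub> f x') = u (f x) \<oplus>\<^bsub>E\<^esub> u (f x')"
      using u[of x] u[of x'] u[of "x \<oplus>\<^bsub>L\<^esub> x'"] x fD DD by simp
    thus "\<phi> (z \<oplus>\<^bsub>?N\<^esub> w) = \<phi> z \<oplus>\<^bsub>E\<^esub> \<phi> w"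
      using x u fD(1) DD(1) by (simp add: \<phi>_def graded_restrict_def jet_module_def E.M.add_diff_add)
  next
    fix r z assume r: "r \<in> carrier S" and "z \<in> carrier ?N"
    then obtain x where x: "x \<in> carrier L" "fst z = f x" "snd z \<in> carrier E"
      by (auto simp: graded_restrict_def N_def)
    have "u (r \<odot>\<^bsub>E\<^esub> f x) = r \<odot>\<^bsub>E\<^esub> u (f x) \<oplus>\<^bsub>E\<^esub> \<delta> r \<odot>\<^bsub>E\<^esub> f x"
      using u[of x] u[of "r \<odot>\<^bsub>L\<^esub> x"] x r closed fD DD by simp
    moreover have "r \<odot>\<^bsub>E\<^esub> (snd z \<ominus>\<^bsub>E\<^esub> u (f x)) = r \<odot>\<^bsub>E\<^esub> snd z \<ominus>\<^bsub>E\<^esub> r \<odot>\<^bsub>E\<^esub> u (f x)"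
      using x r u fD(1) DD(1) by (simp add: E.minus_eq E.smult_r_distr E.smult_r_minus)
    ultimately show "\<phi> (r \<odot>\<^bsub>?N\<^esub> z) = r \<odot>\<^bsub>E\<^esub> \<phi> z"
      using x r u fD(1) DD(1) closed
      by (simp add: \<phi>_def graded_restrict_def jet_module_def E.M.add_diff_cancel_r)
  next
    fix n z assume "z \<in> component ?N n"
    hence "fst z \<in> component E (n + 1)" "fst z \<in> f ` carrier L" "snd z \<in> component E n"
      by (auto simp: graded_restrict_def jet_module_def N_def)
    thus "\<phi> z \<in> component E n"
      using u_component[of "fst z" "n + 1"] by (simp add: \<phi>_def E.minus_eq E.add_component E.minus_component)
  qed
  obtain \<psi> where \<psi>: "\<psi> \<in> graded_hom S (jet_module E) E" "\<And>z. z \<in> N \<Longrightarrow> \<psi> z = \<phi> z"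
    by (rule graded_injectiveD[OF inj g N J.graded_axioms incl _ \<phi>]) (simp_all add: graded_restrict_def)
  note \<psi>D = graded_homD[OF \<psi>(1)]
  have \<psi>_snd: "\<psi> (\<zero>\<^bsub>E\<^esub>, y) = y" if "y \<in> carrier E" for y
  proof -
    have "(\<zero>\<^bsub>E\<^esub>, y) \<in> N" using that f0 by (auto simp: N_def intro: rev_image_eqI)
    moreover have "u \<zero>\<^bsub>E\<^esub> = \<zero>\<^bsub>E\<^esub>" using u[of "\<zero>\<^bsub>L\<^esub>"] f0 ker[of "\<zero>\<^bsub>L\<^esub>"] by simp
    ultimately show ?thesis using \<psi>(2) that by (simp add: \<phi>_def E.minus_eq)
  qed
  show ?thesis
  proof (rule that[of "\<lambda>z. \<ominus>\<^bsub>E\<^esub> \<psi> (z, \<zero>\<^bsub>E\<^esub>)"])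
    fix x assume x: "x \<in> carrier L"
    hence "(f x, \<zero>\<^bsub>E\<^esub>) \<in> N" by (auto simp: N_def)
    thus "\<ominus>\<^bsub>E\<^esub> \<psi> (f x, \<zero>\<^bsub>E\<^esub>) = f (D x)"
      using \<psi>(2) u x fD(1) DD(1) by (simp add: \<phi>_def E.minus_eq)
  next
    have c: "\<psi> (x, y) \<in> carrier E" if "x \<in> carrier E" "y \<in> carrier E" for x y
      using that \<psi>D(1)[of "(x, y)"] by (simp add: jet_module_def)
    show "connection E (\<lambda>z. \<ominus>\<^bsub>E\<^esub> \<psi> (z, \<zero>\<^bsub>E\<^esub>))"
    proof (rule connectionI)
      fix x y assume xy: "x \<in> carrier E" "y \<in> carrier E"
      thus "\<ominus>\<^bsub>E\<^esub> \<psi> (x \<oplus>\<^bsub>E\<^esub> y, \<zero>\<^bsub>E\<^esub>) = \<ominus>\<^bsub>E\<^esub> \<psi> (x, \<zero>\<^bsub>E\<^esub>) \<oplus>\<^bsub>E\<^esub> \<ominus>\<^bsub>E\<^esub> \<psi> (y, \<zero>\<^bsub>E\<^esub>)"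
        using \<psi>D(2)[of "(x, \<zero>\<^bsub>E\<^esub>)" "(y, \<zero>\<^bsub>E\<^esub>)"] c by (simp add: jet_module_def E.M.minus_add)
    next
      fix r x assume rx: "r \<in> carrier S" "x \<in> carrier E"
      hence c': "r \<odot>\<^bsub>E\<^esub> x \<in> carrier E" "\<delta> r \<odot>\<^bsub>E\<^esub> x \<in> carrier E" using closed by auto
      have "r \<odot>\<^bsub>E\<^esub> \<psi> (x, \<zero>\<^bsub>E\<^esub>) = \<psi> (r \<odot>\<^bsub>E\<^esub> x, \<delta> r \<odot>\<^bsub>E\<^esub> x)"
        using \<psi>D(3)[of r "(x, \<zero>\<^bsub>E\<^esub>)"] rx c' by (simp add: jet_module_def)
      also have "\<dots> = \<psi> (r \<odot>\<^bsub>E\<^esub> x, \<zero>\<^bsub>E\<^esub>) \<oplus>\<^bsub>E\<^esub> \<delta> r \<odot>\<^bsub>E\<^esub> x"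
        using \<psi>D(2)[of "(r \<odot>\<^bsub>E\<^esub> x, \<zero>\<^bsub>E\<^esub>)" "(\<zero>\<^bsub>E\<^esub>, \<delta> r \<odot>\<^bsub>E\<^esub> x)"] c' \<psi>_snd
        by (simp add: jet_module_def)
      finally show "\<ominus>\<^bsub>E\<^esub> \<psi> (r \<odot>\<^bsub>E\<^esub> x, \<zero>\<^bsub>E\<^esub>) = r \<odot>\<^bsub>E\<^esub> \<ominus>\<^bsub>E\<^esub> \<psi> (x, \<zero>\<^bsub>E\<^esub>) \<oplus>\<^bsub>E\<^esub> \<delta> r \<odot>\<^bsub>E\<^esub> x"
        using rx c c' by (simp add: E.smult_r_minus E.M.minus_add E.M.a_assoc E.M.l_neg)
    next
      fix n x assume "x \<in> component E n"
      thus "\<ominus>\<^bsub>E\<^esub> \<psi> (x, \<zero>\<^bsub>E\<^esub>) \<in> component E (n - 1)"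
        using \<psi>D(4)[of "(x, \<zero>\<^bsub>E\<^esub>)" "n - 1"] by (simp add: jet_module_def E.minus_component)
    qed (use c in auto)
  qed
qed

section \<open>Connections on an injective resolution\<close>

text \<open>
  The connections are chosen one after another. The kernel of \<open>d i\<close> is the image of the previous
  differential, so a connection that commutes with the previous differential preserves this kernel
  and can be extended along \<open>d i\<close>.
\<close>

lemma (in graded_derivation) resolution_connections:
  fixes E :: "nat \<Rightarrow> ('r, 'e) graded_module" and M :: "('r, 'b) graded_module"
  assumes res: "graded_injective_resolution S M \<epsilon> E d"
    and M: "graded S M" and D: "connection M D"
  obtains DE where "\<And>i. connection (E i) (DE i)"
    "\<And>i x. x \<in> carrier (E i) \<Longrightarrow> DE (Suc i) (d i x) = d i (DE i x)"
proof -
  have E: "graded S (E i)" and inj: "graded_injective TYPE(('r + 'e) list) S (E i)"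
    and d: "d i \<in> graded_hom S (E i) (E (Suc i))"
    and exact: "d i ` carrier (E i) = {x \<in> carrier (E (Suc i)). d (Suc i) x = \<zero>\<^bsub>E (Suc (Suc i))\<^esub>}" for i
    using res unfolding graded_injective_resolution_def graded_def by auto
  have \<epsilon>: "\<epsilon> \<in> graded_hom S M (E 0)" "inj_on \<epsilon> (carrier M)"
    "\<epsilon> ` carrier M = {x \<in> carrier (E 0). d 0 x = \<zero>\<^bsub>E 1\<^esub>}"
    using res unfolding graded_injective_resolution_def by auto
  \<comment> \<open>the test type of the resolution contains the jets of every term\<close>
  let ?g = "\<lambda>z. [Inr (fst z), Inr (snd z)] :: ('r + 'e) list"
  have g: "inj ?g" by (auto simp: inj_def prod_eq_iff)
  define P where "P i D \<longleftrightarrow> connection (E i) D \<and>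
    (\<forall>x\<in>carrier (E i). d i x = \<zero>\<^bsub>E (Suc i)\<^esub> \<longrightarrow> d i (D x) = \<zero>\<^bsub>E (Suc i)\<^esub>)" for i D
  interpret M: graded S M by (rule M)
  have "\<exists>D0. P 0 D0"
  proof -
    interpret E0: graded S "E 0" by (rule E)
    have "\<epsilon> \<zero>\<^bsub>M\<^esub> = \<zero>\<^bsub>E 0\<^esub>"
      by (rule additive_zero[OF M.abelian_group_axioms E0.abelian_group_axioms])
        (use graded_homD(1,2)[OF \<epsilon>(1)] in auto)
    hence "\<epsilon> (D x) = \<zero>\<^bsub>E 0\<^esub>" if "x \<in> carrier M" "\<epsilon> x = \<zero>\<^bsub>E 0\<^esub>" for x
    proof -
      have "x = \<zero>\<^bsub>M\<^esub>" using that \<open>\<epsilon> \<zero>\<^bsub>M\<^esub> = \<zero>\<^bsub>E 0\<^esub>\<close> inj_onD[OF \<epsilon>(2), of x "\<zero>\<^bsub>M\<^esub>"] by simp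
      moreover have "D \<zero>\<^bsub>M\<^esub> = \<zero>\<^bsub>M\<^esub>"
        by (rule additive_zero[OF M.abelian_group_axioms M.abelian_group_axioms])
          (use connectionD(1,2)[OF D] in auto)
      ultimately show ?thesis using \<open>\<epsilon> \<zero>\<^bsub>M\<^esub> = \<zero>\<^bsub>E 0\<^esub>\<close> by simp
    qed
    then obtain D0 where D0: "connection (E 0) D0" "\<And>x. x \<in> carrier M \<Longrightarrow> D0 (\<epsilon> x) = \<epsilon> (D x)"
      using extend_connection[OF g M E inj \<epsilon>(1) D] by blast
    have "d 0 (D0 y) = \<zero>\<^bsub>E (Suc 0)\<^esub>" if "y \<in> carrier (E 0)" "d 0 y = \<zero>\<^bsub>E (Suc 0)\<^esub>" for y
    proof -
      have "y \<in> \<epsilon> ` carrier M" using that unfolding \<epsilon>(3) by simp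
      then obtain x where "x \<in> carrier M" "y = \<epsilon> x" by blast
      hence "D0 y \<in> \<epsilon> ` carrier M" using D0(2) connectionD(1)[OF D] by auto
      thus ?thesis unfolding \<epsilon>(3) by simp
    qed
    thus ?thesis unfolding P_def using D0(1) by blast
  qed
  moreover have "\<exists>D'. P (Suc i) D' \<and> (\<forall>x\<in>carrier (E i). D' (d i x) = d i (D x))" if PD: "P i D" for D i
  proof -
    have D: "connection (E i) D" using PD unfolding P_def by blast
    obtain D' where D': "connection (E (Suc i)) D'"
      "\<And>x. x \<in> carrier (E i) \<Longrightarrow> D' (d i x) = d i (D x)"
      using extend_connection[OF g E E inj d D] PD unfolding P_def by blast
    have "d (Suc i) (D' y) = \<zero>\<^bsub>E (Suc (Suc i))\<^esub>"
      if "y \<in> carrier (E (Suc i))" "d (Suc i) y = \<zero>\<^bsub>E (Suc (Suc i))\<^esub>" for y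
    proof -
      have "y \<in> d i ` carrier (E i)" using that unfolding exact by simp
      then obtain x where "x \<in> carrier (E i)" "y = d i x" by blast
      hence "D' y \<in> d i ` carrier (E i)" using D'(2) connectionD(1)[OF D] by auto
      thus ?thesis unfolding exact by simp
    qed
    thus ?thesis unfolding P_def using D' by blast
  qed
  ultimately obtain DE where "\<And>i. P i (DE i)"
    "\<And>i. \<forall>x\<in>carrier (E i). DE (Suc i) (d i x) = d i (DE i x)"
    using dependent_nat_choice[of P "\<lambda>i D D'. \<forall>x\<in>carrier (E i). D' (d i x) = d i (D x)"] by metis
  thus ?thesis using that unfolding P_def by blast
qed

section \<open>Torsion\<close>

text \<open>
  The condition \<open>I\<^sup>k x = 0\<close>, unfolded one factor at a time. In this form the statements below are
  inductions on \<open>k\<close> that only mention single elements of \<open>I\<close>.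
\<close>

fun power_annihilates ::
  "'r set \<Rightarrow> ('r, 'e, 'y) graded_module_scheme \<Rightarrow> nat \<Rightarrow> 'e \<Rightarrow> bool" where
  "power_annihilates I M 0 x \<longleftrightarrow> x = \<zero>\<^bsub>M\<^esub>"
| "power_annihilates I M (Suc k) x \<longleftrightarrow> (\<forall>b\<in>I. power_annihilates I M k (b \<odot>\<^bsub>M\<^esub> x))"

context graded
begin

lemma power_annihilates_iff:
  assumes I: "ideal I S" and "x \<in> carrier M"
  shows "(\<forall>a \<in> I [^]\<^bsub>ideals_set S\<^esub> k. a \<odot>\<^bsub>M\<^esub> x = \<zero>\<^bsub>M\<^esub>) \<longleftrightarrow> power_annihilates I M k x"
  using assms(2)
proof (induction k arbitrary: x)
  case 0
  have "\<one>\<^bsub>ideals_set S\<^esub> = carrier S" by (simp add: ideals_set_def)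
  moreover have "x = \<zero>\<^bsub>M\<^esub>" if "\<forall>a\<in>carrier S. a \<odot>\<^bsub>M\<^esub> x = \<zero>\<^bsub>M\<^esub>"
    using that[rule_format, OF R.one_closed] 0 by simp
  ultimately show ?case by auto
next
  case (Suc k)
  interpret ideals: comm_monoid "ideals_set S" by (rule R.ideals_set_is_comm_monoid)
  have pow_ideal: "ideal (I [^]\<^bsub>ideals_set S\<^esub> k) S"
    using ideals.nat_pow_closed[of I k] I by (simp add: ideals_set_def)
  have pow: "a \<in> carrier S" if "a \<in> I [^]\<^bsub>ideals_set S\<^esub> k" for a
    by (rule ideal.Icarr[OF pow_ideal that])
  have Ic: "b \<in> carrier S" if "b \<in> I" for b by (rule ideal.Icarr[OF I that])
  have eq: "I [^]\<^bsub>ideals_set S\<^esub> Suc k = ideal_prod S (I [^]\<^bsub>ideals_set S\<^esub> k) I"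
    using ideals.nat_pow_Suc by (simp add: ideals_set_def)
  have "(\<forall>a \<in> ideal_prod S (I [^]\<^bsub>ideals_set S\<^esub> k) I. a \<odot>\<^bsub>M\<^esub> x = \<zero>\<^bsub>M\<^esub>) \<longleftrightarrow>
      (\<forall>b\<in>I. \<forall>a \<in> I [^]\<^bsub>ideals_set S\<^esub> k. a \<odot>\<^bsub>M\<^esub> (b \<odot>\<^bsub>M\<^esub> x) = \<zero>\<^bsub>M\<^esub>)" (is "?l \<longleftrightarrow> ?r")
  proof
    assume ?l
    show ?r
    proof (intro ballI)
      fix a b assume ab: "b \<in> I" "a \<in> I [^]\<^bsub>ideals_set S\<^esub> k"
      hence "(a \<otimes>\<^bsub>S\<^esub> b) \<odot>\<^bsub>M\<^esub> x = \<zero>\<^bsub>M\<^esub>" using \<open>?l\<close> by (auto intro: ideal_prod.prod)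
      thus "a \<odot>\<^bsub>M\<^esub> (b \<odot>\<^bsub>M\<^esub> x) = \<zero>\<^bsub>M\<^esub>" using ab pow Ic Suc.prems by (simp add: smult_assoc1)
    qed
  next
    assume ?r
    have "a \<in> carrier S \<and> a \<odot>\<^bsub>M\<^esub> x = \<zero>\<^bsub>M\<^esub>" if "a \<in> ideal_prod S (I [^]\<^bsub>ideals_set S\<^esub> k) I" for a
      using that
    proof induction
      case (prod a b)
      thus ?case using \<open>?r\<close> pow Ic Suc.prems by (simp add: smult_assoc1)
    next
      case (sum a b)
      thus ?case using Suc.prems by (simp add: smult_l_distr)
    qed
    thus ?l by blast
  qed
  thus ?case using Suc Ic unfolding eq by auto
qed

lemma power_annihilates_zero:
  assumes "I \<subseteq> carrier S"
  shows "power_annihilates I M k \<zero>\<^bsub>M\<^esub>"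
proof (induction k)
  case (Suc k)
  thus ?case using assms by (simp add: subset_iff)
qed simp

lemma power_annihilates_add:
  assumes "I \<subseteq> carrier S" "x \<in> carrier M" "y \<in> carrier M"
    "power_annihilates I M k x" "power_annihilates I M k y"
  shows "power_annihilates I M k (x \<oplus>\<^bsub>M\<^esub> y)"
  using assms(2-)
proof (induction k arbitrary: x y)
  case (Suc k)
  have "power_annihilates I M k (b \<odot>\<^bsub>M\<^esub> (x \<oplus>\<^bsub>M\<^esub> y))" if b: "b \<in> I" for b
  proof -
    have "b \<in> carrier S" using assms(1) b by (rule subsetD)
    thus ?thesis using Suc.prems Suc.IH[of "b \<odot>\<^bsub>M\<^esub> x" "b \<odot>\<^bsub>M\<^esub> y"] b by (simp add: smult_r_distr)
  qed
  thus ?case by simp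
qed simp

lemma power_annihilates_smult:
  assumes "I \<subseteq> carrier S" "x \<in> carrier M" "r \<in> carrier S" "power_annihilates I M k x"
  shows "power_annihilates I M k (r \<odot>\<^bsub>M\<^esub> x)"
  using assms(2,4)
proof (induction k arbitrary: x)
  case (Suc k)
  have "power_annihilates I M k (b \<odot>\<^bsub>M\<^esub> (r \<odot>\<^bsub>M\<^esub> x))" if b: "b \<in> I" for b
  proof -
    have bc: "b \<in> carrier S" using assms(1) b by (rule subsetD)
    have "b \<odot>\<^bsub>M\<^esub> (r \<odot>\<^bsub>M\<^esub> x) = r \<odot>\<^bsub>M\<^esub> (b \<odot>\<^bsub>M\<^esub> x)"
      using bc assms(3) Suc.prems(1) R.m_comm[of b r] by (simp add: smult_assoc1[symmetric])
    thus ?thesis using Suc.prems Suc.IH[of "b \<odot>\<^bsub>M\<^esub> x"] b bc by simp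
  qed
  thus ?case by simp
qed (use assms(3) in simp)

text \<open>
  For homogeneous \<open>b\<close> in \<open>I\<close>, multiplication by \<open>b\<close> carries the degree \<open>n\<close> part of \<open>x\<close> to a homogeneous
  part of \<open>b x\<close>. The scalars \<open>b\<close> for which the induction step works form an ideal, so the
  homogeneous elements, which generate \<open>I\<close>, suffice.
\<close>

lemma power_annihilates_degree_part:
  assumes I: "homogeneous_ideal I S" and S: "\<And>n. component S n \<subseteq> carrier S"
    and x: "x \<in> carrier M" "power_annihilates I M k x"
  shows "power_annihilates I M k (degree_part M n x)"
  using x
proof (induction k arbitrary: x n)
  case (Suc k)
  have ideal: "ideal I S" and gen: "Idl\<^bsub>S\<^esub> (I \<inter> (\<Union>n. component S n)) = I"
    using I unfolding homogeneous_ideal_def by auto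
  have Ic: "I \<subseteq> carrier S" by (rule subsetI) (rule ideal.Icarr[OF ideal])
  let ?h = "degree_part M n x"
  have h: "?h \<in> carrier M" using Suc.prems by simp
  define J where "J = {b \<in> carrier S. power_annihilates I M k (b \<odot>\<^bsub>M\<^esub> ?h)}"
  have "ideal J S"
  proof (rule idealI)
    show "ring S" by (rule R.ring_axioms)
    show "subgroup J (add_monoid S)"
    proof (rule subgroup.intro)
      fix a assume a: "a \<in> J"
      hence "\<ominus>\<^bsub>S\<^esub> a \<odot>\<^bsub>M\<^esub> ?h = \<ominus>\<^bsub>S\<^esub> \<one>\<^bsub>S\<^esub> \<odot>\<^bsub>M\<^esub> (a \<odot>\<^bsub>M\<^esub> ?h)"
        using h by (simp add: J_def smult_assoc1[symmetric] R.l_minus)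
      hence "\<ominus>\<^bsub>S\<^esub> a \<in> J"
        using a h power_annihilates_smult[OF Ic, of "a \<odot>\<^bsub>M\<^esub> ?h" "\<ominus>\<^bsub>S\<^esub> \<one>\<^bsub>S\<^esub>" k] by (simp add: J_def)
      thus "inv\<^bsub>add_monoid S\<^esub> a \<in> J" by (simp add: a_inv_def)
    qed (use h power_annihilates_zero[OF Ic] power_annihilates_add[OF Ic] in \<open>auto simp: J_def smult_l_distr\<close>)
    fix a r assume ar: "a \<in> J" "r \<in> carrier S"
    thus "r \<otimes>\<^bsub>S\<^esub> a \<in> J"
      using h power_annihilates_smult[OF Ic, of "a \<odot>\<^bsub>M\<^esub> ?h" r k] by (simp add: J_def smult_assoc1)
    thus "a \<otimes>\<^bsub>S\<^esub> r \<in> J" using ar by (simp add: J_def R.m_comm)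
  qed
  moreover have "I \<inter> (\<Union>n. component S n) \<subseteq> J"
  proof
    fix b assume "b \<in> I \<inter> (\<Union>n. component S n)"
    then obtain m where b: "b \<in> I" "b \<in> component S m" by blast
    hence "power_annihilates I M k (degree_part M (m + n) (b \<odot>\<^bsub>M\<^esub> x))"
      using Suc.prems Suc.IH Ic by auto
    thus "b \<in> J" using degree_part_smult[of b m x n] b Ic Suc.prems by (auto simp: J_def)
  qed
  ultimately have "I \<subseteq> J" using R.genideal_minimal gen by metis
  thus ?case by (auto simp: J_def)
qed simp

end

text \<open>
  For \<open>b\<close> in \<open>I\<close> use \<open>b (D x) = D (b x) - (\<delta> b) x\<close>. The first term is handled by induction. The second
  is killed by the same power of \<open>I\<close> as \<open>x\<close>, in general by no smaller one because \<open>\<delta> b\<close> need not lie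
  in \<open>I\<close>; hence the loss of one power.
\<close>

lemma (in graded_derivation) power_annihilates_connection:
  assumes "graded S M" "connection M D" "ideal I S" "x \<in> carrier M" "power_annihilates I M k x"
  shows "power_annihilates I M (Suc k) (D x)"
  using assms(4,5)
proof (induction k arbitrary: x)
  interpret M: graded S M by fact
  note DD = connectionD[OF assms(2)]
  have Ic: "I \<subseteq> carrier S" by (rule subsetI) (rule ideal.Icarr[OF assms(3)])
  {
    case 0
    have "D \<zero>\<^bsub>M\<^esub> = \<zero>\<^bsub>M\<^esub>"
      by (rule additive_zero[OF M.abelian_group_axioms M.abelian_group_axioms]) (use DD(1,2) in auto)
    thus ?case using 0 Ic by auto
  next
    case (Suc k)
    have "power_annihilates I M (Suc k) (b \<odot>\<^bsub>M\<^esub> D x)" if b: "b \<in> I" for b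
    proof -
      have bc: "b \<in> carrier S" using b Ic by blast
      have "power_annihilates I M (Suc k) (D (b \<odot>\<^bsub>M\<^esub> x))"
        by (rule Suc.IH) (use Suc.prems b bc in auto)
      moreover have "power_annihilates I M (Suc k) (\<ominus>\<^bsub>S\<^esub> \<delta> b \<odot>\<^bsub>M\<^esub> x)"
        by (rule M.power_annihilates_smult[OF Ic]) (use Suc.prems bc closed in auto)
      moreover have "b \<odot>\<^bsub>M\<^esub> D x = D (b \<odot>\<^bsub>M\<^esub> x) \<oplus>\<^bsub>M\<^esub> \<ominus>\<^bsub>S\<^esub> \<delta> b \<odot>\<^bsub>M\<^esub> x"
        using bc Suc.prems DD closed by (simp add: M.smult_l_minus M.M.a_assoc M.M.r_neg)
      ultimately show ?thesis
        using M.power_annihilates_add[OF Ic, of "D (b \<odot>\<^bsub>M\<^esub> x)" "\<ominus>\<^bsub>S\<^esub> \<delta> b \<odot>\<^bsub>M\<^esub> x" "Suc k"]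
          bc Suc.prems DD(1) closed by simp
    qed
    thus ?case by (subst power_annihilates.simps(2)) blast
  }
qed

definition torsion :: "'r set \<Rightarrow> ('r, 'e, 'y) graded_module_scheme \<Rightarrow> 'e set" where
  "torsion I M = {x \<in> carrier M. \<exists>k. power_annihilates I M k x}"

context graded
begin

lemma power_annihilates_mono:
  assumes "I \<subseteq> carrier S" "x \<in> carrier M" "power_annihilates I M k x" "k \<le> l"
  shows "power_annihilates I M l x"
  using assms(4)
proof (induction l rule: dec_induct)
  case (step l)
  have "power_annihilates I M l (b \<odot>\<^bsub>M\<^esub> x)" if "b \<in> I" for b
    using power_annihilates_smult[OF assms(1,2) subsetD[OF assms(1) that] step.IH] .
  thus ?case by simp
qed (rule assms(3))

lemma torsion_part_eq:
  assumes "ideal I S"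
  shows "{x \<in> carrier M. \<exists>k::nat. \<forall>a \<in> I [^]\<^bsub>ideals_set S\<^esub> k. a \<odot>\<^bsub>M\<^esub> x = \<zero>\<^bsub>M\<^esub>} = torsion I M"
  unfolding torsion_def using power_annihilates_iff[OF assms] by blast

lemma torsion_submodule:
  assumes "I \<subseteq> carrier S"
  shows "submodule (torsion I M) S M"
proof (rule submoduleI)
  show "\<zero>\<^bsub>M\<^esub> \<in> torsion I M"
    using power_annihilates_zero[OF assms] by (simp add: torsion_def)
  show smult: "r \<odot>\<^bsub>M\<^esub> x \<in> torsion I M" if rx: "r \<in> carrier S" "x \<in> torsion I M" for r x
  proof -
    obtain k where "x \<in> carrier M" "power_annihilates I M k x"
      using rx(2) by (auto simp: torsion_def)
    thus ?thesis using rx(1) power_annihilates_smult[OF assms, of x r k] by (auto simp: torsion_def)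
  qed
  show "\<ominus>\<^bsub>M\<^esub> x \<in> torsion I M" if "x \<in> torsion I M" for x
  proof -
    have "x \<in> carrier M" using that by (simp add: torsion_def)
    thus ?thesis using smult[of "\<ominus>\<^bsub>S\<^esub> \<one>\<^bsub>S\<^esub>" x] that by (simp add: smult_l_minus)
  qed
  show "x \<oplus>\<^bsub>M\<^esub> y \<in> torsion I M" if xy: "x \<in> torsion I M" "y \<in> torsion I M" for x y
  proof -
    obtain k l where x: "x \<in> carrier M" "power_annihilates I M k x"
      and y: "y \<in> carrier M" "power_annihilates I M l y"
      using xy by (auto simp: torsion_def)
    have "power_annihilates I M (max k l) (x \<oplus>\<^bsub>M\<^esub> y)"
      by (intro power_annihilates_add[OF assms x(1) y(1)] power_annihilates_mono[OF assms x]
          power_annihilates_mono[OF assms y]) simp_all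
    thus ?thesis using x(1) y(1) by (auto simp: torsion_def)
  qed
qed (auto simp: torsion_def)

lemma torsion_degree_part:
  assumes "homogeneous_ideal I S" "\<And>n. component S n \<subseteq> carrier S" "x \<in> torsion I M"
  shows "degree_part M n x \<in> torsion I M"
proof -
  obtain k where "x \<in> carrier M" "power_annihilates I M k x"
    using assms(3) by (auto simp: torsion_def)
  thus ?thesis using power_annihilates_degree_part[OF assms(1,2), of x k n] by (auto simp: torsion_def)
qed

end

lemma (in graded_derivation) torsion_connection:
  assumes "graded S M" "connection M D" "ideal I S" "x \<in> torsion I M"
  shows "D x \<in> torsion I M"
proof -
  obtain k where "x \<in> carrier M" "power_annihilates I M k x"
    using assms(4) by (auto simp: torsion_def)
  hence "D x \<in> carrier M" "power_annihilates I M (Suc k) (D x)"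
    using connectionD(1)[OF assms(2)] power_annihilates_connection[OF assms(1-3)] by blast+
  thus ?thesis unfolding torsion_def by blast
qed

section \<open>Vanishing of cohomology in bounded degrees\<close>

text \<open>
  Think of \<open>\<xi> n\<close> as \<open>X\<^sup>n\<close> with \<open>\<delta> X = 1\<close> and the natural numbers invertible. If \<open>\<xi> (n + 1)\<close> maps \<open>Z\<close>
  into \<open>B\<close>, then so does \<open>\<delta> (\<xi> (n + 1))\<close>, as \<open>(\<delta> (\<xi> (n + 1))) z = D (\<xi> (n + 1) z) - \<xi> (n + 1) (D z)\<close>,
  and therefore its multiple \<open>\<xi> n\<close>. Iterating reaches \<open>\<xi> 0 = 1\<close>.
\<close>

lemma (in graded_derivation) connection_descent:
  assumes M: "graded S M" and D: "connection M D"
    and Z: "Z \<subseteq> carrier M" "\<And>z. z \<in> Z \<Longrightarrow> D z \<in> Z"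
    and B: "submodule B S M" "\<And>z. z \<in> B \<Longrightarrow> D z \<in> B"
    and \<xi>: "\<And>n. \<xi> n \<in> carrier S" "\<xi> 0 = \<one>\<^bsub>S\<^esub>"
      "\<And>n. \<exists>c\<in>carrier S. c \<otimes>\<^bsub>S\<^esub> \<delta> (\<xi> (Suc n)) = \<xi> n"
    and N: "\<And>z. z \<in> Z \<Longrightarrow> \<xi> N \<odot>\<^bsub>M\<^esub> z \<in> B"
  shows "Z \<subseteq> B"
proof -
  interpret M: graded S M by (rule M)
  note DD = connectionD[OF D] and sub = M.submoduleE[OF B(1)]
  have step: "\<forall>z\<in>Z. \<xi> n \<odot>\<^bsub>M\<^esub> z \<in> B"
    if IH: "\<forall>z\<in>Z. \<xi> (Suc n) \<odot>\<^bsub>M\<^esub> z \<in> B" for n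
  proof
    fix z assume z: "z \<in> Z"
    have zc: "z \<in> carrier M" "D z \<in> carrier M"
      by (rule subsetD[OF Z(1)], fact z, rule subsetD[OF Z(1) Z(2)[OF z]])
    obtain c where c: "c \<in> carrier S" "c \<otimes>\<^bsub>S\<^esub> \<delta> (\<xi> (Suc n)) = \<xi> n" using \<xi>(3)[of n] by (elim bexE)
    let ?a = "\<xi> (Suc n) \<odot>\<^bsub>M\<^esub> D z" and ?b = "\<delta> (\<xi> (Suc n)) \<odot>\<^bsub>M\<^esub> z"
    have ab: "?a \<in> carrier M" "?b \<in> carrier M" using zc \<xi>(1) closed by simp_all
    hence "?b = (?b \<oplus>\<^bsub>M\<^esub> ?a) \<oplus>\<^bsub>M\<^esub> \<ominus>\<^bsub>M\<^esub> ?a" by (simp add: M.M.a_assoc M.M.r_neg)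
    also have "?b \<oplus>\<^bsub>M\<^esub> ?a = D (\<xi> (Suc n) \<odot>\<^bsub>M\<^esub> z)"
      using DD(3)[OF \<xi>(1) zc(1)] M.M.a_comm[OF ab] by simp
    finally have "?b = D (\<xi> (Suc n) \<odot>\<^bsub>M\<^esub> z) \<oplus>\<^bsub>M\<^esub> \<ominus>\<^bsub>M\<^esub> ?a" .
    moreover have "\<xi> (Suc n) \<odot>\<^bsub>M\<^esub> z \<in> B" "\<xi> (Suc n) \<odot>\<^bsub>M\<^esub> D z \<in> B"
      using IH z Z(2)[OF z] by simp_all
    ultimately have "\<delta> (\<xi> (Suc n)) \<odot>\<^bsub>M\<^esub> z \<in> B"
      using sub(3,5) B(2) by simp
    from sub(4)[OF c(1) this] show "\<xi> n \<odot>\<^bsub>M\<^esub> z \<in> B"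
      using zc(1) c \<xi>(1) closed by (simp add: M.smult_assoc1[symmetric])
  qed
  have "(\<forall>z\<in>Z. \<xi> n \<odot>\<^bsub>M\<^esub> z \<in> B) \<longrightarrow> (\<forall>z\<in>Z. \<xi> 0 \<odot>\<^bsub>M\<^esub> z \<in> B)" for n
    by (induction n) (use step in blast)+
  hence "\<forall>z\<in>Z. \<xi> 0 \<odot>\<^bsub>M\<^esub> z \<in> B" using N by blast
  thus ?thesis using \<xi>(2) Z(1) by (auto simp: subset_iff)
qed

text \<open>
  Here \<open>Z\<close> and \<open>B\<close> are the cocycles and coboundaries of the torsion complex. A connection on the
  resolution preserves both. Multiplication by \<open>\<xi> N\<close> raises degrees by \<open>N\<close>, so for large \<open>N\<close> it moves
  every degree in which the cohomology may be nonzero to one in which it vanishes, and descent applies.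
\<close>

lemma (in graded_derivation) local_cohomology_eq_zero:
  fixes E :: "nat \<Rightarrow> ('r, 'e) graded_module" and M :: "('r, 'b) graded_module"
  assumes res: "graded_injective_resolution S M \<epsilon> E d"
    and M: "graded S M" and D: "connection M D"
    and I: "homogeneous_ideal I S"
    and \<xi>: "\<And>n. \<xi> n \<in> component S (int n)" "\<xi> 0 = \<one>\<^bsub>S\<^esub>"
      "\<And>n. \<exists>c\<in>carrier S. c \<otimes>\<^bsub>S\<^esub> \<delta> (\<xi> (Suc n)) = \<xi> n"
    and H: "H = local_cohomology S I E d i"
    and bounded: "\<And>n. \<bar>n\<bar> > n\<^sub>0 \<Longrightarrow> component H n = {\<zero>\<^bsub>H\<^esub>}"
  shows "carrier H = {\<zero>\<^bsub>H\<^esub>}"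
proof -
  have E: "graded S (E j)" and d: "d j \<in> graded_hom S (E j) (E (Suc j))" for j
    using res unfolding graded_injective_resolution_def graded_def by auto
  have ideal: "ideal I S" using I unfolding homogeneous_ideal_def by blast
  have Ic: "I \<subseteq> carrier S" by (rule subsetI) (rule ideal.Icarr[OF ideal])
  interpret E: graded S "E i" by (rule E)
  interpret E': graded S "E (Suc i)" by (rule E)
  obtain DE where DE: "\<And>j. connection (E j) (DE j)"
    "\<And>j x. x \<in> carrier (E j) \<Longrightarrow> DE (Suc j) (d j x) = d j (DE j x)"
    using resolution_connections[OF res M D] by blast
  have DE_zero: "DE j \<zero>\<^bsub>E j\<^esub> = \<zero>\<^bsub>E j\<^esub>" for j
  proof -
    interpret Ej: graded S "E j" by (rule E)
    show ?thesis
      by (rule additive_zero[OF Ej.abelian_group_axioms Ej.abelian_group_axioms])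
        (use connectionD(1,2)[OF DE(1)] in auto)
  qed
  define Z where "Z = {x \<in> torsion I (E i). d i x = \<zero>\<^bsub>E (Suc i)\<^esub>}"
  define B where "B = (case i of 0 \<Rightarrow> {\<zero>\<^bsub>E 0\<^esub>} | Suc j \<Rightarrow> d j ` torsion I (E j))"
  have torsion_part: "torsion_part S I (E j) = graded_restrict (E j) (torsion I (E j))" for j
    unfolding torsion_part_def graded.torsion_part_eq[OF E ideal] ..
  let ?Z = "graded_restrict (graded_restrict (E i) (torsion I (E i))) Z"
  have H_eq: "H = graded_quotient ?Z B"
  proof -
    have "cocycles (\<lambda>j. torsion_part S I (E j)) d i = Z"
      by (simp add: cocycles_def torsion_part graded_restrict_def Z_def)
    moreover have "coboundaries (\<lambda>j. torsion_part S I (E j)) d i = B"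
      by (simp add: coboundaries_def torsion_part graded_restrict_def B_def split: nat.split)
    ultimately show ?thesis
      unfolding H local_cohomology_def cohomology_def by (simp add: torsion_part)
  qed
  have coset: "B +>\<^bsub>?Z\<^esub> x = (\<lambda>b. b \<oplus>\<^bsub>E i\<^esub> x) ` B" for x
    by (auto simp: a_r_coset_def' graded_restrict_def)
  have carrier_H: "carrier H = (\<lambda>x. (\<lambda>b. b \<oplus>\<^bsub>E i\<^esub> x) ` B) ` Z"
    by (auto simp: H_eq graded_quotient_def A_RCOSETS_def' coset[symmetric] graded_restrict_def
        a_r_coset_def')
  have component_H: "component H n = (\<lambda>x. (\<lambda>b. b \<oplus>\<^bsub>E i\<^esub> x) ` B) ` (component (E i) n \<inter> Z)" for n
    unfolding H_eq graded_quotient_def coset by (auto simp: graded_restrict_def Z_def)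
  have zero_H: "\<zero>\<^bsub>H\<^esub> = B" by (simp add: H_eq graded_quotient_def)

  note T = E.torsion_submodule[OF Ic]
  note Tsub = E.submoduleE[OF T]
  note dD = graded_homD[OF d]
  have Zc: "x \<in> carrier (E i)" if "x \<in> Z" for x using that by (simp add: Z_def torsion_def)
  have B: "submodule B S (E i)"
  proof (cases i)
    case 0
    have "submodule {\<zero>\<^bsub>E i\<^esub>} S (E i)" by (rule E.submoduleI) auto
    thus ?thesis using 0 by (simp add: B_def)
  next
    case (Suc j)
    interpret Ej: graded S "E j" by (rule E)
    have "submodule (d j ` torsion I (E j)) S (E (Suc j))"
      by (rule submodule_image[OF Ej.module_axioms _ _ dD(2,3) Ej.torsion_submodule[OF Ic]])
        (use dD(1) E.module_axioms Suc in auto)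
    thus ?thesis using Suc by (simp add: B_def)
  qed
  note Bsub = E.submoduleE[OF B]
  have B_zero: "\<zero>\<^bsub>E i\<^esub> \<in> B" using subgroup.one_closed[OF submodule.axioms(1)[OF B]] by simp
  have B_D: "DE i b \<in> B" if b: "b \<in> B" for b
  proof (cases i)
    case 0
    thus ?thesis using b DE_zero[of 0] by (simp add: B_def)
  next
    case (Suc j)
    then obtain x where x: "x \<in> torsion I (E j)" "b = d j x" using b by (auto simp: B_def)
    hence "DE i b = d j (DE j x)" using DE(2)[of x j] Suc by (simp add: torsion_def)
    thus ?thesis using torsion_connection[OF E DE(1) ideal x(1)] Suc by (simp add: B_def)
  qed
  have Z_D: "DE i z \<in> Z" if "z \<in> Z" for z
  proof -
    have "d i (DE i z) = DE (Suc i) (d i z)" using DE(2)[of z i] Zc[OF that] by simp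
    thus ?thesis using that torsion_connection[OF E DE(1) ideal, of z i] DE_zero[of "Suc i"]
      by (simp add: Z_def)
  qed
  have Z_degree_part: "degree_part (E i) n z \<in> Z" if "z \<in> Z" for n z
  proof -
    have "degree_part (E (Suc i)) (0 + n) (d i z) = d i (degree_part (E i) n z)"
      by (rule degree_part_shift[OF E E]) (simp_all add: dD(1,2) dD(4) Zc[OF that])
    thus ?thesis using that E.torsion_degree_part[OF I component_subset, of z n] by (simp add: Z_def)
  qed
  have Z_smult: "r \<odot>\<^bsub>E i\<^esub> z \<in> Z" if "r \<in> carrier S" "z \<in> Z" for r z
    using that dD(3)[of r z i] Zc[of z] Tsub(4)[of r z] by (simp add: Z_def)
  have Z_component: "x \<in> B" if "\<bar>n\<bar> > n\<^sub>0" "x \<in> component (E i) n" "x \<in> Z" for n x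
  proof -
    have "(\<lambda>b. b \<oplus>\<^bsub>E i\<^esub> x) ` B \<in> component H n" unfolding component_H using that(2,3) by blast
    hence "(\<lambda>b. b \<oplus>\<^bsub>E i\<^esub> x) ` B = B" using bounded[OF that(1)] zero_H by simp
    moreover have "x = \<zero>\<^bsub>E i\<^esub> \<oplus>\<^bsub>E i\<^esub> x" using Zc[OF that(3)] by simp
    ultimately show ?thesis using B_zero by (metis imageI)
  qed

  \<comment> \<open>\<open>-n\<^sub>0 \<le> n\<close> gives \<open>N + n > n\<^sub>0\<close>; the absolute value covers a negative \<open>n\<^sub>0\<close>\<close>
  define N where "N = nat (2 * \<bar>n\<^sub>0\<bar> + 1)"
  have \<xi>c: "\<xi> n \<in> carrier S" for n using component_subset \<xi>(1) by (rule subsetD)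
  have "\<xi> N \<odot>\<^bsub>E i\<^esub> z \<in> B" if z: "z \<in> Z" for z
    using Zc[OF z]
  proof (induction z rule: E.degree_part_induct)
    case (degree_part n)
    let ?x = "degree_part (E i) n z"
    have x: "?x \<in> Z" "?x \<in> component (E i) n"
      using Z_degree_part[OF z] E.degree_part_decomposition(1)[OF Zc[OF z]] by simp_all
    show ?case
    proof (cases "\<bar>n\<bar> > n\<^sub>0")
      case True
      from Bsub(4)[OF \<xi>c Z_component[OF this x(2,1)]] show ?thesis .
    next
      case False
      have "\<xi> N \<odot>\<^bsub>E i\<^esub> ?x \<in> component (E i) (int N + n)"
        by (rule E.smult_component[OF \<xi>(1) x(2)])
      moreover have "\<bar>int N + n\<bar> > n\<^sub>0" using False by (simp add: N_def)
      ultimately show ?thesis using Z_component Z_smult[OF \<xi>c x(1)] by blast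
    qed
  next
    case zero
    show ?case using B_zero \<xi>c by simp
  next
    case (add y z)
    thus ?case using Bsub(5) \<xi>c by (simp add: E.smult_r_distr)
  qed
  hence "Z \<subseteq> B"
    by (intro connection_descent[OF E DE(1) _ Z_D B B_D \<xi>c \<xi>(2,3)]) (use Zc in auto)
  have "(\<lambda>b. b \<oplus>\<^bsub>E i\<^esub> x) ` B = B" if "x \<in> B" for x
  proof
    show "(\<lambda>b. b \<oplus>\<^bsub>E i\<^esub> x) ` B \<subseteq> B" using Bsub(5) that by blast
    show "B \<subseteq> (\<lambda>b. b \<oplus>\<^bsub>E i\<^esub> x) ` B"
    proof
      fix b assume b: "b \<in> B"
      have "x \<in> carrier (E i)" "b \<in> carrier (E i)" using Bsub(1) that b by (auto dest: subsetD)
      hence "b = (b \<oplus>\<^bsub>E i\<^esub> \<ominus>\<^bsub>E i\<^esub> x) \<oplus>\<^bsub>E i\<^esub> x" by (simp add: E.M.a_assoc E.M.l_neg)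
      moreover have "b \<oplus>\<^bsub>E i\<^esub> \<ominus>\<^bsub>E i\<^esub> x \<in> B" using Bsub(3)[OF that] Bsub(5)[OF b] by blast
      ultimately show "b \<in> (\<lambda>b. b \<oplus>\<^bsub>E i\<^esub> x) ` B" by (rule image_eqI)
    qed
  qed
  hence "carrier H \<subseteq> {B}" unfolding carrier_H using \<open>Z \<subseteq> B\<close> by blast
  moreover have "\<zero>\<^bsub>E i\<^esub> \<in> Z"
  proof -
    have "d i \<zero>\<^bsub>E i\<^esub> = \<zero>\<^bsub>E (Suc i)\<^esub>"
      by (rule additive_zero[OF E.abelian_group_axioms E'.abelian_group_axioms])
        (use dD(1,2) in auto)
    thus ?thesis using subgroup.one_closed[OF submodule.axioms(1)[OF T]] by (simp add: Z_def)
  qed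
  ultimately show ?thesis unfolding zero_H carrier_H by blast
qed

section \<open>The standard graded polynomial ring\<close>

lemma poly_mapping_single_induct [case_names zero single add]:
  fixes p :: "'a \<Rightarrow>\<^sub>0 'b::comm_monoid_add"
  assumes "P 0" "\<And>t c. P (Poly_Mapping.single t c)" "\<And>p q. P p \<Longrightarrow> P q \<Longrightarrow> P (p + q)"
  shows "P p"
proof (induction p rule: Poly_Mapping.update_induct)
  case (update p t c)
  have "Poly_Mapping.update t c p = p + Poly_Mapping.single t c"
    using update(1)
    by (intro poly_mapping_eqI) (auto simp: lookup_update lookup_add lookup_single when_def in_keys_iff)
  thus ?case using update assms by simp
qed (rule assms(1))

definition monomial_degree :: "('v::finite \<Rightarrow>\<^sub>0 nat) \<Rightarrow> int" where
  "monomial_degree t = int (\<Sum>v\<in>UNIV. Poly_Mapping.lookup t v)"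

lemma monomial_degree_add: "monomial_degree (s + t) = monomial_degree s + monomial_degree t"
  by (simp add: monomial_degree_def lookup_add sum.distrib)

lemma monomial_degree_single: "monomial_degree (Poly_Mapping.single v n) = int n"
  by (simp add: monomial_degree_def lookup_single when_def)

lemma keys_mult_degree:
  fixes p q :: "('v::finite, 'a::comm_ring_1) mpolynomial"
  assumes "\<forall>t\<in>Poly_Mapping.keys p. monomial_degree t = k" "\<forall>t\<in>Poly_Mapping.keys q. monomial_degree t = n"
    "t \<in> Poly_Mapping.keys (p * q)"
  shows "monomial_degree t = k + n"
  using keys_mult[of p q] assms by (auto simp: monomial_degree_add)

lemma standard_graded_polynomial_ring_simps [simp]:
  "carrier standard_graded_polynomial_ring = UNIV"
  "p \<otimes>\<^bsub>standard_graded_polynomial_ring\<^esub> q = p * q"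
  "\<one>\<^bsub>standard_graded_polynomial_ring\<^esub> = 1"
  "\<zero>\<^bsub>standard_graded_polynomial_ring\<^esub> = 0"
  "p \<oplus>\<^bsub>standard_graded_polynomial_ring\<^esub> q = p + q"
  "p \<odot>\<^bsub>standard_graded_polynomial_ring\<^esub> q = p * q"
  "component standard_graded_polynomial_ring n = {p. \<forall>t\<in>Poly_Mapping.keys p. monomial_degree t = n}"
  by (simp_all add: standard_graded_polynomial_ring_def monomial_degree_def)

lemma cring_polynomial_ring:
  "cring (standard_graded_polynomial_ring ::
     (('v::finite, 'a::comm_ring_1) mpolynomial, _) graded_module)"
proof (rule cringI)
  let ?R = "standard_graded_polynomial_ring :: (('v, 'a) mpolynomial, _) graded_module"
  show "abelian_group ?R"
  proof (rule abelian_groupI)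
    fix p assume "p \<in> carrier ?R"
    show "\<exists>q\<in>carrier ?R. q \<oplus>\<^bsub>?R\<^esub> p = \<zero>\<^bsub>?R\<^esub>"
      by (rule bexI[of _ "- p"]) simp_all
  qed (simp_all add: algebra_simps)
  show "comm_monoid ?R"
    by (rule comm_monoidI) (simp_all add: algebra_simps)
qed (simp add: distrib_right)

definition homogeneous_part :: "int \<Rightarrow> ('v::finite, 'a::comm_ring_1) mpolynomial \<Rightarrow> ('v, 'a) mpolynomial" where
  "homogeneous_part n = Poly_Mapping.mapp (\<lambda>t c. c when monomial_degree t = n)"

lemma lookup_homogeneous_part:
  "Poly_Mapping.lookup (homogeneous_part n p) t = (Poly_Mapping.lookup p t when monomial_degree t = n)"
  by (auto simp: homogeneous_part_def lookup_mapp when_def in_keys_iff)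

lemma graded_module_polynomial_ring:
  "graded_module standard_graded_polynomial_ring
     (standard_graded_polynomial_ring :: (('v::finite, 'a::comm_ring_1) mpolynomial, _) graded_module)"
    (is "graded_module _ ?R")
proof (rule graded_moduleI[where p = homogeneous_part])
  interpret R: cring ?R by (rule cring_polynomial_ring)
  show "module ?R ?R"
    by (rule moduleI)
      (simp_all add: R.abelian_group_axioms cring_polynomial_ring distrib_left distrib_right mult.assoc)
next
  fix n :: int and p q :: "('v, 'a) mpolynomial"
  assume "p \<in> component ?R n" "q \<in> component ?R n"
  thus "p \<oplus>\<^bsub>?R\<^esub> q \<in> component ?R n" using Poly_Mapping.keys_add[of p q] by auto
next
  fix n :: int and p :: "('v, 'a) mpolynomial"
  assume "p \<in> component ?R n"
  thus "\<exists>q\<in>component ?R n. q \<oplus>\<^bsub>?R\<^esub> p = \<zero>\<^bsub>?R\<^esub>"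
    by (intro bexI[of _ "- p"]) (auto simp: in_keys_iff)
next
  fix k n :: int and p q :: "('v, 'a) mpolynomial"
  assume "p \<in> component ?R k" "q \<in> component ?R n"
  thus "p \<odot>\<^bsub>?R\<^esub> q \<in> component ?R (k + n)" using keys_mult_degree[of p k q n] by simp
next
  fix p :: "('v, 'a) mpolynomial"
  have "{n. homogeneous_part n p \<noteq> 0} \<subseteq> monomial_degree ` Poly_Mapping.keys p"
  proof
    fix n assume "n \<in> {n. homogeneous_part n p \<noteq> 0}"
    then obtain t where "Poly_Mapping.lookup (homogeneous_part n p) t \<noteq> 0"
      using poly_mapping_eqI[of "homogeneous_part n p" 0] by auto
    thus "n \<in> monomial_degree ` Poly_Mapping.keys p"
      by (auto simp: lookup_homogeneous_part when_def in_keys_iff split: if_splits)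
  qed
  thus "finite {n. homogeneous_part n p \<noteq> \<zero>\<^bsub>?R\<^esub>}" by (simp add: finite_subset)
next
  fix p :: "('v, 'a) mpolynomial"
  assume 0: "\<And>n. homogeneous_part n p = \<zero>\<^bsub>?R\<^esub>"
  have "Poly_Mapping.lookup p t = 0" for t
    using lookup_homogeneous_part[of "monomial_degree t" p t] 0 by simp
  thus "p = \<zero>\<^bsub>?R\<^esub>" by (simp add: poly_mapping_eqI)
qed (auto intro!: poly_mapping_eqI simp: lookup_homogeneous_part lookup_add when_def in_keys_iff
      split: if_splits)

lift_definition partial_derivative ::
  "'v \<Rightarrow> (('v \<Rightarrow>\<^sub>0 nat) \<Rightarrow>\<^sub>0 'a::comm_ring_1) \<Rightarrow> (('v \<Rightarrow>\<^sub>0 nat) \<Rightarrow>\<^sub>0 'a)"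
  is "\<lambda>v p t. of_nat (Suc (Poly_Mapping.lookup t v)) * p (t + Poly_Mapping.single v 1)"
proof -
  fix v :: 'v and p :: "('v \<Rightarrow>\<^sub>0 nat) \<Rightarrow> 'a"
  assume "finite {t. p t \<noteq> 0}"
  hence "finite ((\<lambda>t. t + Poly_Mapping.single v (1::nat)) -` {t. p t \<noteq> 0})"
    by (rule finite_vimageI) (auto intro: injI)
  thus "finite {t. of_nat (Suc (Poly_Mapping.lookup t v)) * p (t + Poly_Mapping.single v 1) \<noteq> 0}"
    by (rule rev_finite_subset) auto
qed

lemma partial_derivative_add:
  "partial_derivative v (p + q) = partial_derivative v p + partial_derivative v q"
  by transfer (simp add: fun_eq_iff algebra_simps)

lemma partial_derivative_zero [simp]: "partial_derivative v 0 = 0"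
  by transfer simp

text \<open>
  Subtraction of exponents is truncated: if \<open>X\<^sub>v\<close> does not occur in the monomial, the exponent on the right
  is wrong, but then the coefficient is zero.
\<close>

lemma partial_derivative_single:
  "partial_derivative v (Poly_Mapping.single t c) =
     Poly_Mapping.single (t - Poly_Mapping.single v 1) (of_nat (Poly_Mapping.lookup t v) * c)"
proof (rule poly_mapping_eqI)
  fix s
  have "Poly_Mapping.lookup t v = 0 \<or> s = t - Poly_Mapping.single v 1 \<longleftrightarrow> 
    Poly_Mapping.lookup t v = 0 \<or> t = s + Poly_Mapping.single v 1"
    by (auto simp: poly_mapping_eq_iff fun_eq_iff lookup_minus lookup_add lookup_single when_def)
  moreover have "Poly_Mapping.lookup t v = Suc (Poly_Mapping.lookup s v)" if "t = s + Poly_Mapping.single v 1"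
    unfolding that by (simp add: lookup_add)
  ultimately show "Poly_Mapping.lookup (partial_derivative v (Poly_Mapping.single t c)) s =
    Poly_Mapping.lookup (Poly_Mapping.single (t - Poly_Mapping.single v 1)
      (of_nat (Poly_Mapping.lookup t v) * c)) s"
    by (cases "Poly_Mapping.lookup t v = 0")
      (auto simp: partial_derivative.rep_eq lookup_single when_def)
qed

lemma partial_derivative_mult:
  "partial_derivative v (p * q) = p * partial_derivative v q + partial_derivative v p * q"
proof (induction p rule: poly_mapping_single_induct)
  case (single s c)
  show ?case
  proof (induction q rule: poly_mapping_single_induct)
    case (single t b)
    let ?s = "Poly_Mapping.lookup s v" and ?t = "Poly_Mapping.lookup t v"
    let ?e = "Poly_Mapping.single v 1 :: 'a \<Rightarrow>\<^sub>0 nat"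
    have "Poly_Mapping.single (s + (t - ?e)) (c * (of_nat ?t * b)) =
        Poly_Mapping.single (s + t - ?e) (of_nat ?t * (c * b))"
    proof (cases "?t = 0")
      case False
      hence "s + (t - ?e) = s + t - ?e"
        by (auto simp: poly_mapping_eq_iff fun_eq_iff lookup_minus lookup_add lookup_single when_def)
      thus ?thesis by (simp add: mult.left_commute)
    qed simp
    moreover have "Poly_Mapping.single (s - ?e + t) (of_nat ?s * c * b) =
        Poly_Mapping.single (s + t - ?e) (of_nat ?s * (c * b))"
    proof (cases "?s = 0")
      case False
      hence "s - ?e + t = s + t - ?e"
        by (auto simp: poly_mapping_eq_iff fun_eq_iff lookup_minus lookup_add lookup_single when_def)
      thus ?thesis by (simp add: mult.assoc)
    qed simp
    ultimately show ?case
      by (simp add: mult_single partial_derivative_single lookup_add distrib_right single_add)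
  qed (simp_all add: algebra_simps partial_derivative_add)
qed (simp_all add: algebra_simps partial_derivative_add)

lemma graded_derivation_partial_derivative:
  "graded_derivation standard_graded_polynomial_ring
     (partial_derivative v :: ('v::finite, 'a::comm_ring_1) mpolynomial \<Rightarrow> _)"
proof (rule graded_derivation.intro)
  fix p :: "('v, 'a) mpolynomial" and k
  assume p: "p \<in> component standard_graded_polynomial_ring k"
  have "monomial_degree t = k - 1" if "t \<in> Poly_Mapping.keys (partial_derivative v p)" for t
  proof -
    have "t + Poly_Mapping.single v 1 \<in> Poly_Mapping.keys p"
      using that by (auto simp: in_keys_iff partial_derivative.rep_eq)
    hence "monomial_degree t + 1 = k"
      using p by (auto simp: monomial_degree_add monomial_degree_single)
    thus ?thesis by simp
  qed
  thus "partial_derivative v p \<in> component standard_graded_polynomial_ring (k - 1)" by simp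
qed (auto simp: partial_derivative_add partial_derivative_mult intro: cring_polynomial_ring)

section \<open>Local cohomology of polynomial rings\<close>

theorem theorem1p2:
  fixes A :: "'a::comm_ring_1 ring"
    and K :: "'a set"
    and R :: "(('v::finite, 'a) mpolynomial, ('v, 'a) mpolynomial) graded_module"
    and I :: "('v, 'a) mpolynomial set"
    and \<epsilon> :: "('v, 'a) mpolynomial \<Rightarrow> 'e"
    and E :: "nat \<Rightarrow> (('v, 'a) mpolynomial, 'e) graded_module"
    and d :: "nat \<Rightarrow> 'e \<Rightarrow> 'e"
    and i :: nat
    and M :: "(('v, 'a) mpolynomial, 'e set) graded_module"
  assumes "A = ring_of_type_algebra"
    and "noetherian_ring A"
    and "subfield K A"
    and "\<forall>n::nat. n > 0 \<longrightarrow> [n] \<cdot>\<^bsub>A\<lparr>carrier := K\<rparr>\<^esub> \<one>\<^bsub>A\<^esub> \<noteq> \<zero>\<^bsub>A\<^esub>"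
    and "R = standard_graded_polynomial_ring"
    and "homogeneous_ideal I R"
    and "graded_injective_resolution R R \<epsilon> E d"
    and "M = local_cohomology R I E d i"
    and "\<exists>n\<^sub>0::int. \<forall>n. \<bar>n\<bar> > n\<^sub>0 \<longrightarrow> component M n = {\<zero>\<^bsub>M\<^esub>}"
  shows "carrier M = {\<zero>\<^bsub>M\<^esub>}"
proof -
  \<comment> \<open>an arbitrary variable; the index type is nonempty\<close>
  define v :: 'v where "v = undefined"
  interpret graded_derivation R "partial_derivative v"
    unfolding assms(5) by (rule graded_derivation_partial_derivative)
  have R: "graded R R"
    unfolding assms(5) graded_def by (rule graded_module_polynomial_ring)
  have D: "connection R (partial_derivative v)"
    by (rule connectionI) (use closed additive Leibniz degree in \<open>simp_all add: assms(5)\<close>)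
  have inverse: "\<exists>c. c * of_nat (Suc n) = (1 :: 'a)" for n
  proof -
    interpret K: subfield K A by (rule assms(3))
    have A: "\<one>\<^bsub>A\<^esub> = 1" "\<zero>\<^bsub>A\<^esub> = 0" "x \<oplus>\<^bsub>A\<^esub> y = x + y" "x \<otimes>\<^bsub>A\<^esub> y = x * y" for x y
      by (simp_all add: assms(1) ring_of_type_algebra_def)
    have pow: "[k] \<cdot>\<^bsub>A\<lparr>carrier := K\<rparr>\<^esub> \<one>\<^bsub>A\<^esub> = of_nat k" for k :: nat
      by (induction k) (simp_all add: add_pow_def nat_pow_def A add.commute)
    have "of_nat k \<in> K" for k
      by (induction k) (use subringE(2,3,7)[OF K.subring_axioms] in \<open>auto simp: A\<close>)
    moreover have "of_nat (Suc n) \<noteq> (0 :: 'a)"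
      using assms(4)[rule_format, of "Suc n", unfolded pow] unfolding A by simp
    ultimately have "of_nat (Suc n) \<in> Units (A\<lparr>carrier := K\<rparr>)"
      unfolding K.subfield_Units by (simp add: A del: of_nat_Suc)
    thus ?thesis by (auto simp: Units_def A)
  qed
  \<comment> \<open>\<open>\<xi> n = X\<^sub>v\<^sup>n\<close>\<close>
  define \<xi> where "\<xi> n = Poly_Mapping.single (Poly_Mapping.single v n) (1 :: 'a)" for n :: nat
  obtain n\<^sub>0 where n\<^sub>0: "\<And>n. \<bar>n\<bar> > n\<^sub>0 \<Longrightarrow> component M n = {\<zero>\<^bsub>M\<^esub>}"
    using assms(9) by blast
  show ?thesis
  proof (rule local_cohomology_eq_zero[OF assms(7) R D assms(6) _ _ _ assms(8) n\<^sub>0])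
    show "\<xi> n \<in> component R (int n)" for n :: nat
      by (simp add: \<xi>_def assms(5) monomial_degree_single)
    show "\<xi> 0 = \<one>\<^bsub>R\<^esub>" by (simp add: \<xi>_def assms(5))
    show "\<exists>c\<in>carrier R. c \<otimes>\<^bsub>R\<^esub> partial_derivative v (\<xi> (Suc n)) = \<xi> n" for n
    proof -
      obtain c :: 'a where "c * of_nat (Suc n) = 1" using inverse by blast
      moreover have "Poly_Mapping.single v (Suc n) - Poly_Mapping.single v 1 = Poly_Mapping.single v n"
        by (rule poly_mapping_eqI) (simp add: lookup_minus lookup_single when_def)
      ultimately show ?thesis
        by (intro bexI[of _ "Poly_Mapping.single 0 c"])
          (simp_all add: \<xi>_def assms(5) partial_derivative_single mult_single del: of_nat_Suc)
    qed
  qed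
qed

end
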